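(* Away from the singular set $\mathfrak X_{\rm CR}\cap\mathfrak X^*$, the triple $(\mathfrak X^*,I,J)$ is a pseudoconformal (psc) manifold. Moreover, the ${\rm CR}$ submanifold structure of $(\mathfrak X^*,I,J)$ induced by its pseudoconformality coincides with the codimension 2 ${\rm CR}$ submanifold structure $\mathcal H$ inherited from $\mathbb C^3$; that is, if $\iota:\mathfrak X^*\hookrightarrow\mathbb C^3$ is the inclusion, then $\iota_*\mathcal H^{(1,0)}(\mathfrak X^*,I)$ is the restriction of $\mathcal H^{(1,0)}=\langle Z\rangle$.
   Context: Cross-ratio variety: $\mathfrak X$ is the set of $(\mathbb X_1,\mathbb X_2,\mathbb X_3)\in\mathbb C^3$ with $|\mathbb X_3|^2=|\mathbb X_2|^2/|\mathbb X_1|^2$ and $2|\mathbb X_1|^2\Re(\mathbb X_3)=|\mathbb X_1|^2+|\mathbb X_2|^2-2\Re(\mathbb X_1)-2\Re(\mathbb X_2)+1$. Put $\mathfrak X^*=\{(\mathbb X_1,\mathbb X_2,\mathbb X_3)\in\mathfrak X:\Im(\mathbb X_3)\neq0\}$ (a smooth real 4-dimensional submanifold of $\mathbb C^3$), $\mathfrak X^*_{\pm}=\{\pm\Im(\mathbb X_3)>0\}\subset\mathfrak X^*$, and $$\mathfrak X_{\rm CR}=\{(\mathbb X_1,\mathbb X_2,\mathbb X_3)\in\mathfrak X:\ \mathbb X_1+\mathbb X_2=1,\ 1/\mathbb X_2+1/\mathbb X_3=1,\ \mathbb X_3+1/\mathbb X_1=1\}.$$ Complex structure $I$ on $\mathfrak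 X^*$: the one given by the two non-overlapping charts $(\mathfrak X^*_\pm,\mathcal M_\pm)$, where $\mathcal M_\pm(\mathbb X_1,\mathbb X_2,\mathbb X_3)=(\mathbb X_1,\mathbb X_2)\in\mathbb C^2$. Complex structure $J$ on $\mathfrak X^*$: the one making the homeomorphism $\mathcal N:\mathfrak X^*\to\mathbb CP^1\times(\mathbb C\setminus\mathbb R)$ a biholomorphism, where $\mathcal N(\mathbb X_1,\mathbb X_2,\mathbb X_3)=([z_1:z_4],\mathbb X_3)$. Here $[z_1:z_4]=[\mathbb X_1+\mathbb X_2/\mathbb X_3:\mathbb X_1+\mathbb X_2-1]$ when these two entries are not both zero, and $[z_1:z_4]=[0:1]$ when both are zero (which happens exactly on $\mathfrak X_{\rm CR}\cap \mathfrak X^*$). (Geometrically, $p_1=(z_1,t_1)$, $p_2=\infty$, $p_3=(0,0)$, $p_4=(z_4,t_4)$ is a normalised quadruple in $S^3=(\mathbb C\times\mathbb R)\cup\{\infty\}$ with these cross-ratios.) Psc manifold: a real 4-manifold $M$ with two complex structures $I$, $J$ such that there is a complex 1-dimensional subbundle $\mathcal H^{(1,0)}(M,I)\subset T^{(1,0)}(M,I)$ with $({\rm id})_*\mathcal H^{(1,0)}(M,I)\subset T^{(1,0)}(M,J)$, ${\rm id}:(M,I)\to(M,J)$, and this subbundle is maximal, in terms of both dimension and uniqueness: any subbundle of $T^{(1,0)}(M,I)$ mapped by ${\rm id}_*$ into $T^{(1,0)}(M,J)$ equals $\mathcal H^{(1,0)}(M,I)$. Then $I\equiv J$ on the underlying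 real rank 2 bundle $\mathcal H(M)$ and $(\mathcal H(M),I)=(\mathcal H(M),J)$ is the codimension 2 ${\rm CR}$ structure induced by pseudoconformality. "Away from a set $S$" means on the complement of $S$. ${\rm CR}$ submanifold structure from $\mathbb C^3$: with $\mathbb J$ the complex structure of $\mathbb C^3$, on $\mathfrak X\setminus\mathfrak X_{\rm CR}$ it is $\mathcal H=T\cap\mathbb JT$ ($T$ the tangent bundle), with $\mathcal H^{(1,0)}=\{X-i\mathbb JX: X\in\mathcal H\}$ generated by $$Z=D_{\zeta_2,\zeta_3}\frac{\partial}{\partial\zeta_1}+D_{\zeta_3,\zeta_1}\frac{\partial}{\partial\zeta_2}+D_{\zeta_1,\zeta_2}\frac{\partial}{\partial\zeta_3},$$ where $D_{\zeta_2,\zeta_3}=\frac{|\zeta_2|^2}{|\zeta_3|^2}(\overline{\zeta_2}\,\overline{\zeta_3}-\overline{\zeta_2}-\overline{\zeta_3})$, $D_{\zeta_3,\zeta_1}=\overline{\zeta_3}|\zeta_1|^2(1+\overline{\zeta_1}\,\overline{\zeta_3}-\overline{\zeta_1})$, $D_{\zeta_1,\zeta_2}=\frac{\overline{\zeta_2}}{\zeta_1}(1-\overline{\zeta_1}-\overline{\zeta_2})$, and $(\zeta_1,\zeta_2,\zeta_3)$ are the coordinates of $\mathbb C^3$. *)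

theory Defs
  imports "HOL-Analysis.Analysis"
begin

section \<open>Smooth maps and embedded submanifolds of Euclidean spaces\<close>

primrec Ck_on :: "nat \<Rightarrow> 'a::euclidean_space set \<Rightarrow> ('a \<Rightarrow> 'b::euclidean_space) \<Rightarrow> bool" where
  "Ck_on 0 S f \<longleftrightarrow> continuous_on S f"
| "Ck_on (Suc k) S f \<longleftrightarrow>
     (\<forall>x\<in>S. f differentiable (at x)) \<and>
     (\<forall>v. Ck_on k S (\<lambda>x. frechet_derivative f (at x) v))"

text \<open>Only meant for open \<open>S\<close>; on arbitrary sets use \<open>smooth_map_on\<close>.\<close>

definition smooth_on :: "'a::euclidean_space set \<Rightarrow> ('a \<Rightarrow> 'b::euclidean_space) \<Rightarrow> bool" where
  "smooth_on S f \<longleftrightarrow> (\<forall>k. Ck_on k S f)"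

definition smooth_map_on :: "'a::euclidean_space set \<Rightarrow> ('a \<Rightarrow> 'b::euclidean_space) \<Rightarrow> bool" where
  "smooth_map_on S f \<longleftrightarrow>
     (\<forall>p\<in>S. \<exists>W g. open W \<and> p \<in> W \<and> smooth_on W g \<and> (\<forall>x\<in>W \<inter> S. g x = f x))"

text \<open>A chart \<open>\<phi>\<close> of the subset \<open>M\<close>, with open domain \<open>U\<close>: a homeomorphism onto an open set of the
  model space whose inverse is a smooth immersion into the ambient space. A set covered by such charts
  is an embedded submanifold, and then its charts are exactly the charts of its smooth structure.\<close>

definition smooth_chart ::
  "'a::euclidean_space set \<Rightarrow> 'a set \<Rightarrow> ('a \<Rightarrow> 'b::euclidean_space) \<Rightarrow> bool" where
  "smooth_chart M U \<phi> \<longleftrightarrow>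
     openin (top_of_set M) U \<and> open (\<phi> ` U) \<and>
     (\<exists>\<psi>. homeomorphism U (\<phi> ` U) \<phi> \<psi> \<and> smooth_on (\<phi> ` U) \<psi> \<and>
          (\<forall>y\<in>\<phi> ` U. inj (frechet_derivative \<psi> (at y))))"

definition real_four_manifold :: "'a::euclidean_space set \<Rightarrow> bool" where
  "real_four_manifold M \<longleftrightarrow>
     (\<forall>p\<in>M. \<exists>U (\<phi> :: 'a \<Rightarrow> real^4). p \<in> U \<and> smooth_chart M U \<phi>)"

definition tangent_space :: "'a::euclidean_space set \<Rightarrow> 'a \<Rightarrow> 'a set" where
  "tangent_space M p =
     {v. \<exists>\<epsilon> \<gamma>. 0 < \<epsilon> \<and> smooth_on {-\<epsilon><..<\<epsilon>} \<gamma> \<and> \<gamma> ` {-\<epsilon><..<\<epsilon>} \<subseteq> M \<and>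
               \<gamma> (0::real) = p \<and> (\<gamma> has_vector_derivative v) (at 0)}"

section \<open>Complexified tangent vectors\<close>

text \<open>The pair \<open>(u, v)\<close> stands for \<open>u + i v\<close> in the complexification of the ambient real vector
  space, where \<open>i\<close> is the formal imaginary unit (not a complex structure of the ambient space).\<close>

definition cscale :: "complex \<Rightarrow> 'a::real_vector \<times> 'a \<Rightarrow> 'a \<times> 'a" where
  "cscale c = (\<lambda>(u, v). (Re c *\<^sub>R u - Im c *\<^sub>R v, Im c *\<^sub>R u + Re c *\<^sub>R v))"

definition cspan_fam :: "nat \<Rightarrow> (nat \<Rightarrow> 'a::real_vector \<times> 'a) \<Rightarrow> ('a \<times> 'a) set" where
  "cspan_fam k s = {\<Sum>i<k. cscale (c i) (s i) | c. True}"

definition cindep_fam :: "nat \<Rightarrow> (nat \<Rightarrow> 'a::real_vector \<times> 'a) \<Rightarrow> bool" where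
  "cindep_fam k s \<longleftrightarrow> (\<forall>c. (\<Sum>i<k. cscale (c i) (s i)) = 0 \<longrightarrow> (\<forall>i<k. c i = 0))"

text \<open>Smooth complex rank \<open>k\<close> subbundle of a bundle with fibres \<open>E p\<close> contained in the complexified
  tangent spaces of \<open>M\<close>; only the fibres \<open>H p\<close> with \<open>p \<in> M\<close> matter.\<close>

definition complex_subbundle ::
  "nat \<Rightarrow> 'a::euclidean_space set \<Rightarrow> ('a \<Rightarrow> ('a \<times> 'a) set) \<Rightarrow> ('a \<Rightarrow> ('a \<times> 'a) set) \<Rightarrow> bool" where
  "complex_subbundle k M E H \<longleftrightarrow>
     (\<forall>p\<in>M. H p \<subseteq> E p) \<and>
     (\<forall>p\<in>M. \<exists>U s. openin (top_of_set M) U \<and> p \<in> U \<and>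
        (\<forall>i<k. smooth_map_on U (s i)) \<and>
        (\<forall>q\<in>U. cindep_fam k (\<lambda>i. s i q) \<and> H q = cspan_fam k (\<lambda>i. s i q)))"

section \<open>Complex structures\<close>

definition holomorphic_map_on :: "(complex^'m) set \<Rightarrow> (complex^'m \<Rightarrow> complex^'n) \<Rightarrow> bool" where
  "holomorphic_map_on S f \<longleftrightarrow>
     (\<forall>z\<in>S. \<exists>f'. (f has_derivative f') (at z) \<and> (\<forall>c v. f' (c *s v) = c *s f' v))"

type_synonym 'a atlas = "('a set \<times> ('a \<Rightarrow> complex^2)) set"

definition complex_structure :: "'a::euclidean_space set \<Rightarrow> 'a atlas \<Rightarrow> bool" where
  "complex_structure M A \<longleftrightarrow>
     (\<forall>(U, \<phi>)\<in>A. smooth_chart M U \<phi>) \<and>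
     (\<Union>(U, \<phi>)\<in>A. U) = M \<and>
     (\<forall>(U, \<phi>)\<in>A. \<forall>(V, \<eta>)\<in>A. holomorphic_map_on (\<phi> ` (U \<inter> V)) (\<eta> \<circ> inv_into U \<phi>))"

definition restrict_atlas :: "'a set \<Rightarrow> 'a atlas \<Rightarrow> 'a atlas" where
  "restrict_atlas S A = (\<lambda>(U, \<phi>). (U \<inter> S, \<phi>)) ` A"

text \<open>Multiplication by \<open>i\<close> on the tangent space at \<open>p\<close>, transported from \<open>\<complex>\<^sup>2\<close> by the differential
  of the inverse of a chart of \<open>A\<close> around \<open>p\<close>. For a complex structure on a submanifold the result
  does not depend on the chart.\<close>

definition cstr_op :: "'a::euclidean_space atlas \<Rightarrow> 'a \<Rightarrow> 'a \<Rightarrow> 'a" where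
  "cstr_op A p v = (THE w. \<exists>(U, \<phi>)\<in>A. p \<in> U \<and>
     (\<exists>\<xi>. v = frechet_derivative (inv_into U \<phi>) (at (\<phi> p)) \<xi> \<and>
          w = frechet_derivative (inv_into U \<phi>) (at (\<phi> p)) (\<i> *s \<xi>)))"

text \<open>The vectors \<open>X - i I X\<close>.\<close>

definition T10 :: "'a::euclidean_space set \<Rightarrow> 'a atlas \<Rightarrow> 'a \<Rightarrow> ('a \<times> 'a) set" where
  "T10 M A p = {(X, - cstr_op A p X) | X. X \<in> tangent_space M p}"

section \<open>Pseudoconformal manifolds\<close>

text \<open>Both complex structures live on the same submanifold, so the differential of
  \<open>id : (M, I) \<rightarrow> (M, J)\<close> is the identity of the complexified tangent spaces.\<close>

definition psc_compatible ::
  "nat \<Rightarrow> 'a::euclidean_space set \<Rightarrow> 'a atlas \<Rightarrow> 'a atlas \<Rightarrow> ('a \<Rightarrow> ('a \<times> 'a) set) \<Rightarrow> bool" where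
  "psc_compatible k M I J H \<longleftrightarrow>
     complex_subbundle k M (T10 M I) H \<and> (\<forall>p\<in>M. H p \<subseteq> T10 M J p)"

text \<open>Maximality quantifies over subbundles of every positive rank; the zero bundle, which is
  always compatible, has to be left out.\<close>

definition psc_bundle ::
  "'a::euclidean_space set \<Rightarrow> 'a atlas \<Rightarrow> 'a atlas \<Rightarrow> ('a \<Rightarrow> ('a \<times> 'a) set) \<Rightarrow> bool" where
  "psc_bundle M I J H \<longleftrightarrow>
     psc_compatible 1 M I J H \<and>
     (\<forall>k\<ge>1. \<forall>H'. psc_compatible k M I J H' \<longrightarrow> (\<forall>p\<in>M. H' p = H p))"

definition psc_manifold :: "'a::euclidean_space set \<Rightarrow> 'a atlas \<Rightarrow> 'a atlas \<Rightarrow> bool" where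
  "psc_manifold M I J \<longleftrightarrow>
     real_four_manifold M \<and> complex_structure M I \<and> complex_structure M J \<and>
     (\<exists>H. psc_bundle M I J H)"

text \<open>The real bundle underlying a bundle of vectors \<open>X - i I X\<close> consists of the \<open>X\<close>.\<close>

definition underlying_real :: "('a \<Rightarrow> ('a \<times> 'a) set) \<Rightarrow> 'a \<Rightarrow> 'a set" where
  "underlying_real H p = fst ` H p"

section \<open>The CR structure of a subset of complex coordinate space\<close>

definition CR_space :: "(complex^'n) set \<Rightarrow> complex^'n \<Rightarrow> (complex^'n) set" where
  "CR_space M p = tangent_space M p \<inter> (\<lambda>v. \<i> *s v) ` tangent_space M p"

definition CR10 :: "(complex^'n) set \<Rightarrow> complex^'n \<Rightarrow> ((complex^'n) \<times> (complex^'n)) set" where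
  "CR10 M p = {(X, - (\<i> *s X)) | X. X \<in> CR_space M p}"

text \<open>The complexified vector \<open>\<Sum>\<^sub>j a\<^sub>j \<partial>/\<partial>\<zeta>\<^sub>j\<close>. Since
  \<open>\<partial>/\<partial>\<zeta> = (\<partial>/\<partial>x - i \<partial>/\<partial>y)/2\<close>, it is \<open>X - i (\<i> X)\<close> for \<open>X = a/2\<close>.\<close>

definition d_zeta :: "complex^'n \<Rightarrow> (complex^'n) \<times> (complex^'n)" where
  "d_zeta a = ((1/2) *\<^sub>R a, - ((1/2) *\<^sub>R (\<i> *s a)))"

section \<open>The cross-ratio variety\<close>

text \<open>The non-vanishing conditions below are implicit in the quotients; they are needed because
  \<open>x / 0 = 0\<close> in HOL.\<close>

definition crvar :: "(complex^3) set" where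
  "crvar = {X. X$1 \<noteq> 0 \<and>
     (cmod (X$3))^2 = (cmod (X$2))^2 / (cmod (X$1))^2 \<and>
     2 * (cmod (X$1))^2 * Re (X$3) =
       (cmod (X$1))^2 + (cmod (X$2))^2 - 2 * Re (X$1) - 2 * Re (X$2) + 1}"

definition crvar_star :: "(complex^3) set" where
  "crvar_star = {X \<in> crvar. Im (X$3) \<noteq> 0}"

definition crvar_plus :: "(complex^3) set" where
  "crvar_plus = {X \<in> crvar_star. Im (X$3) > 0}"

definition crvar_minus :: "(complex^3) set" where
  "crvar_minus = {X \<in> crvar_star. - Im (X$3) > 0}"

definition crvar_CR :: "(complex^3) set" where
  "crvar_CR = {X \<in> crvar. X$2 \<noteq> 0 \<and> X$3 \<noteq> 0 \<and>
     X$1 + X$2 = 1 \<and> 1 / X$2 + 1 / X$3 = 1 \<and> X$3 + 1 / X$1 = 1}"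

definition crmap_M :: "complex^3 \<Rightarrow> complex^2" where
  "crmap_M X = vector [X$1, X$2]"

definition I_atlas :: "(complex^3) atlas" where
  "I_atlas = {(crvar_plus, crmap_M), (crvar_minus, crmap_M)}"

text \<open>Points of the complex projective line are the lines in \<open>\<complex>\<^sup>2\<close>; \<open>hpoint a b\<close> is \<open>[a : b]\<close>.\<close>

definition hpoint :: "complex \<Rightarrow> complex \<Rightarrow> (complex^2) set" where
  "hpoint a b = {c *s vector [a, b] | c. True}"

definition CP1 :: "(complex^2) set set" where
  "CP1 = {hpoint a b | a b. a \<noteq> 0 \<or> b \<noteq> 0}"

text \<open>The two affine coordinates, \<open>b/a\<close> and \<open>a/b\<close> on \<open>[a : b]\<close>, and the resulting charts of
  the product of the projective line with \<open>\<complex> - \<real>\<close>.\<close>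

definition affine1 :: "(complex^2) set \<Rightarrow> complex" where
  "affine1 L = (THE t. L = hpoint 1 t)"

definition affine2 :: "(complex^2) set \<Rightarrow> complex" where
  "affine2 L = (THE t. L = hpoint t 1)"

definition CP1_C_atlas :: "((complex^2) set \<times> complex) atlas" where
  "CP1_C_atlas =
     {((CP1 - {hpoint 0 1}) \<times> (UNIV - \<real>), \<lambda>(L, z). vector [affine1 L, z]),
      ((CP1 - {hpoint 1 0}) \<times> (UNIV - \<real>), \<lambda>(L, z). vector [affine2 L, z])}"

definition crmap_N :: "complex^3 \<Rightarrow> (complex^2) set \<times> complex" where
  "crmap_N X =
     (let a = X$1 + X$2 / X$3; b = X$1 + X$2 - 1
      in (if a = 0 \<and> b = 0 then hpoint 0 1 else hpoint a b, X$3))"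

definition J_atlas :: "(complex^3) atlas" where
  "J_atlas = (\<lambda>(W, \<phi>). ({X \<in> crvar_star. crmap_N X \<in> W}, \<phi> \<circ> crmap_N)) ` CP1_C_atlas"

text \<open>The complement of the singular set in \<open>crvar_star\<close>, with the two complex structures
  restricted to it.\<close>

definition crvar_reg :: "(complex^3) set" where
  "crvar_reg = crvar_star - (crvar_CR \<inter> crvar_star)"

definition I_reg :: "(complex^3) atlas" where
  "I_reg = restrict_atlas crvar_reg I_atlas"

definition J_reg :: "(complex^3) atlas" where
  "J_reg = restrict_atlas crvar_reg J_atlas"

definition Z_coeff :: "complex^3 \<Rightarrow> complex^3" where
  "Z_coeff X =
     (let \<zeta>1 = X$1; \<zeta>2 = X$2; \<zeta>3 = X$3 in
      vector
       [of_real ((cmod \<zeta>2)^2 / (cmod \<zeta>3)^2) * (cnj \<zeta>2 * cnj \<zeta>3 - cnj \<zeta>2 - cnj \<zeta>3),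
        cnj \<zeta>3 * of_real ((cmod \<zeta>1)^2) * (1 + cnj \<zeta>1 * cnj \<zeta>3 - cnj \<zeta>1),
        cnj \<zeta>2 / \<zeta>1 * (1 - cnj \<zeta>1 - cnj \<zeta>2)])"

definition Z_field :: "complex^3 \<Rightarrow> (complex^3) \<times> (complex^3)" where
  "Z_field X = d_zeta (Z_coeff X)"

end

theory Submission
  imports Defs
begin

text \<open>
  Write \<open>(x, y, z)\<close> for the three cross-ratios, \<open>T\<close> for the tangent space of the regular part of the
  variety at a point, and \<open>i\<close> for the multiplication of the ambient space \<open>\<complex>\<^sup>3\<close>.

  Both complex structures are given by functions that are holomorphic on open subsets of \<open>\<complex>\<^sup>3\<close>: \<open>I\<close> by
  \<open>(x, y)\<close>, and \<open>J\<close> by \<open>(t, z)\<close> with \<open>t = (x + y - 1) / (x + y/z)\<close>. Their differentials are therefore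
  complex linear for \<open>i\<close>, and injective on \<open>T\<close>. If \<open>I X = J X\<close> for some \<open>X\<close> in \<open>T\<close>, then
  the first two coordinates of this vector are those of \<open>i X\<close> because of \<open>I\<close>, and the third one
  because of \<open>J\<close>; so \<open>I X = J X = i X\<close>, and \<open>i X\<close> is tangent. Conversely, if \<open>X\<close> and \<open>i X\<close> are both
  tangent, then \<open>i X\<close> has the property that defines \<open>I X\<close> and \<open>J X\<close>
  (lemma \<open>cstr_op_eq_ambient\<close>). Hence the vectors \<open>X - i I X\<close> that are of type \<open>(1,0)\<close> for both
  structures are the vectors of the CR structure \<open>T \<inter> i T\<close> inherited from \<open>\<complex>\<^sup>3\<close>
  (lemmas \<open>cstr_ops_ambient\<close> and \<open>T10_common\<close>).

  The space \<open>T\<close> is cut out by the real parts of two complex linear forms, the \<open>\<partial>\<close>-derivatives of the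
  two defining equations (lemma \<open>tangent_space_crvar_reg\<close>). So \<open>T \<inter> i T\<close> is the common kernel of
  these forms, and it is spanned by their cross product when that vector is not zero. On the variety
  the cross product is \<open>-Z\<close>, and \<open>Z\<close> vanishes nowhere on the regular part
  (lemmas \<open>Z_coeff_cross\<close>, \<open>Z_coeff_nonzero\<close> and \<open>complex_tangent_iff\<close>). Thus the common vectors form
  the complex line bundle spanned by \<open>Z\<close>; every compatible subbundle of positive rank lies in a bundle
  of rank one, and so equals it (lemma \<open>psc_bundle_iff\<close>).

  It remains to see that \<open>I\<close> and \<open>J\<close> are complex structures on the regular part, for which the charts
  need smooth inverses. The equations determine the modulus and the real part of \<open>z\<close> from \<open>(x, y)\<close>,
  hence \<open>z\<close> up to the sign of its imaginary part; this inverts the charts of \<open>I\<close>. For \<open>J\<close>, the first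
  equation says that \<open>y / (x z)\<close> lies on the unit circle, and the second one becomes linear in a
  rational parameter of the circle; this gives \<open>(x, y)\<close> as a rational expression in \<open>t\<close>, \<open>z\<close> and their
  conjugates (lemmas \<open>inv_N_properties\<close> and \<open>inv_N_J_coord1\<close>). The value \<open>[0 : 1]\<close> of the projective
  coordinate is taken only on the singular set, so that the affine coordinate \<open>t\<close> is a global chart of
  the regular part.
\<close>

section \<open>Calculus of smooth maps\<close>

lemma frechet_derivative_cong_open:
  assumes "open S" "x \<in> S" "\<And>y. y \<in> S \<Longrightarrow> f y = g y"
  shows "frechet_derivative f (at x) = frechet_derivative g (at x)"
proof -
  have "(f has_derivative D) (at x) \<longleftrightarrow> (g has_derivative D) (at x)" for D
    using has_derivative_transform_within_open[of f D x UNIV S g]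
      has_derivative_transform_within_open[of g D x UNIV S f] assms by auto
  then show ?thesis by (simp add: frechet_derivative_def)
qed

lemma Ck_on_Suc_has_derivative:
  assumes "Ck_on (Suc k) S f" "x \<in> S"
  shows "(f has_derivative frechet_derivative f (at x)) (at x)"
  using assms by (simp add: frechet_derivative_works)

lemma Ck_on_cong:
  assumes "open S" "\<And>x. x \<in> S \<Longrightarrow> f x = g x" "Ck_on k S f"
  shows "Ck_on k S g"
  using assms(2,3)
proof (induction k arbitrary: f g)
  case 0
  then show ?case using continuous_on_cong[of S S f g] by auto
next
  case (Suc k)
  have d: "g differentiable (at x)" if "x \<in> S" for x
    unfolding differentiable_def
    using Ck_on_Suc_has_derivative[OF Suc.prems(2) that]
      has_derivative_transform_within_open[of f _ x UNIV S g] Suc.prems(1) that assms(1) by blast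
  have "Ck_on k S (\<lambda>x. frechet_derivative g (at x) v)" for v
    using Suc.IH[of "\<lambda>x. frechet_derivative f (at x) v" "\<lambda>x. frechet_derivative g (at x) v"]
      Suc.prems frechet_derivative_cong_open[OF assms(1), of _ f g] by simp
  with d show ?case by simp
qed

text \<open>The recursion behind \<open>Ck_on\<close>, freed from \<open>frechet_derivative\<close>: any expression for the
  derivative can be used.\<close>

lemma Ck_on_SucI:
  assumes "open S" "\<And>x. x \<in> S \<Longrightarrow> (f has_derivative f' x) (at x)"
    "\<And>v. Ck_on k S (\<lambda>x. f' x v)"
  shows "Ck_on (Suc k) S f"
proof -
  have "Ck_on k S (\<lambda>x. frechet_derivative f (at x) v)" for v
    by (rule Ck_on_cong[OF assms(1) _ assms(3)[of v]]) (simp add: frechet_derivative_at[OF assms(2), symmetric])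
  with assms(2) show ?thesis by (auto simp: differentiable_def)
qed

lemma Ck_on_Suc_imp: "Ck_on (Suc k) S f \<Longrightarrow> Ck_on k S f"
proof (induction k arbitrary: f)
  case 0
  then show ?case
    by (auto intro!: continuous_at_imp_continuous_on differentiable_imp_continuous_within)
next
  case (Suc k)
  have "Ck_on k S (\<lambda>x. frechet_derivative f (at x) v)" for v
    using Suc.prems by (intro Suc.IH) simp
  with Suc.prems show ?case by simp
qed

lemma Ck_on_const: "open S \<Longrightarrow> Ck_on k S (\<lambda>x. c)"
proof (induction k arbitrary: c)
  case (Suc k)
  then show ?case by (intro Ck_on_SucI[where f' = "\<lambda>_ _. 0"]) auto
qed auto

lemma Ck_on_bounded_linear:
  assumes "bounded_linear h" "open S" "Ck_on k S f"
  shows "Ck_on k S (\<lambda>x. h (f x))"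
  using assms(3)
proof (induction k arbitrary: f)
  case 0
  then show ?case using assms(1) by (simp add: bounded_linear.continuous_on)
next
  case (Suc k)
  show ?case
    by (intro Ck_on_SucI[where f' = "\<lambda>x v. h (frechet_derivative f (at x) v)"] assms(2)
        bounded_linear.has_derivative[OF assms(1)] Ck_on_Suc_has_derivative[OF Suc.prems] Suc.IH)
      (use Suc.prems in simp_all)
qed

lemma Ck_on_ident: "open S \<Longrightarrow> Ck_on k S (\<lambda>x. x)"
proof (cases k)
  case (Suc n)
  assume "open S"
  then show ?thesis unfolding Suc
    by (intro Ck_on_SucI[where f' = "\<lambda>_ v. v"]) (auto intro: Ck_on_const)
qed auto

lemma Ck_on_add:
  assumes "open S" "Ck_on k S f" "Ck_on k S g"
  shows "Ck_on k S (\<lambda>x. f x + g x)"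
  using assms(2,3)
proof (induction k arbitrary: f g)
  case 0
  then show ?case by (simp add: continuous_on_add)
next
  case (Suc k)
  show ?case
    by (intro Ck_on_SucI[where f' = "\<lambda>x v. frechet_derivative f (at x) v + frechet_derivative g (at x) v"]
        assms(1) has_derivative_add Ck_on_Suc_has_derivative[OF Suc.prems(1)]
        Ck_on_Suc_has_derivative[OF Suc.prems(2)] Suc.IH)
      (use Suc.prems in simp_all)
qed

lemma Ck_on_sum:
  assumes "open S" "finite A" "\<And>i. i \<in> A \<Longrightarrow> Ck_on k S (f i)"
  shows "Ck_on k S (\<lambda>x. \<Sum>i\<in>A. f i x)"
  using assms(2,3) by induction (auto intro!: Ck_on_const Ck_on_add assms(1))

lemma Ck_on_bounded_bilinear:
  assumes "bounded_bilinear pr" "open S" "Ck_on k S f" "Ck_on k S g"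
  shows "Ck_on k S (\<lambda>x. pr (f x) (g x))"
  using assms(3,4)
proof (induction k arbitrary: f g)
  case 0
  then show ?case using bounded_bilinear.continuous_on[OF assms(1)] by simp
next
  case (Suc k)
  show ?case
  proof (rule Ck_on_SucI[OF assms(2)])
    show "((\<lambda>x. pr (f x) (g x)) has_derivative
        (\<lambda>v. pr (f x) (frechet_derivative g (at x) v) + pr (frechet_derivative f (at x) v) (g x))) (at x)"
      if "x \<in> S" for x
      by (intro bounded_bilinear.FDERIV[OF assms(1)] Suc.prems[THEN Ck_on_Suc_has_derivative] that)
    show "Ck_on k S (\<lambda>x. pr (f x) (frechet_derivative g (at x) v)
        + pr (frechet_derivative f (at x) v) (g x))" for v
      by (intro Ck_on_add assms(2) Suc.IH Suc.prems[THEN Ck_on_Suc_imp]) (use Suc.prems in simp_all)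
  qed
qed

text \<open>Induction on the order: by the chain rule the derivative is again a sum of products of
  functions of lower order.\<close>

lemma Ck_on_compose:
  fixes f :: "'a::euclidean_space \<Rightarrow> 'b::euclidean_space" and g :: "'b \<Rightarrow> 'c::euclidean_space"
  assumes "open S" "open T" "f ` S \<subseteq> T" "Ck_on k S f" "Ck_on k T g"
  shows "Ck_on k S (\<lambda>x. g (f x))"
  using assms(4,5)
proof (induction k arbitrary: g)
  case 0
  then show ?case using continuous_on_compose2 assms(3) by auto
next
  case (Suc k)
  let ?f' = "\<lambda>x. frechet_derivative f (at x)" and ?g' = "\<lambda>y. frechet_derivative g (at y)"
  show ?case
  proof (rule Ck_on_SucI[OF assms(1)])
    show "((\<lambda>x. g (f x)) has_derivative (\<lambda>v. \<Sum>b\<in>Basis. (?f' x v \<bullet> b) *\<^sub>R ?g' (f x) b)) (at x)"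
      if "x \<in> S" for x
    proof -
      have f: "(f has_derivative ?f' x) (at x)" and g: "(g has_derivative ?g' (f x)) (at (f x))"
        using Ck_on_Suc_has_derivative Suc.prems that assms(3) by blast+
      \<comment> \<open>The direction \<open>?f' x v\<close> depends on \<open>x\<close>, whereas the hypothesis controls the derivative of
        \<open>g\<close> only in fixed directions; hence the expansion in the basis.\<close>
      have "?g' (f x) w = (\<Sum>b\<in>Basis. (w \<bullet> b) *\<^sub>R ?g' (f x) b)" for w
        using linear_sum[OF has_derivative_linear[OF g], of "\<lambda>b. (w \<bullet> b) *\<^sub>R b" Basis]
        by (simp add: euclidean_representation linear_cmul[OF has_derivative_linear[OF g]])
      then have "(\<lambda>v. ?g' (f x) (?f' x v)) = (\<lambda>v. \<Sum>b\<in>Basis. (?f' x v \<bullet> b) *\<^sub>R ?g' (f x) b)"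
        by (rule ext)
      with has_derivative_compose[OF f g] show ?thesis by (simp only:)
    qed
    show "Ck_on k S (\<lambda>x. \<Sum>b\<in>Basis. (?f' x v \<bullet> b) *\<^sub>R ?g' (f x) b)" for v
    proof (intro Ck_on_sum assms(1) Ck_on_bounded_bilinear[OF bounded_bilinear_scaleR])
      fix b :: 'b assume "b \<in> Basis"
      show "Ck_on k S (\<lambda>x. ?f' x v \<bullet> b)"
        using Suc.prems(1) by (intro Ck_on_bounded_linear[OF bounded_linear_inner_left assms(1)]) auto
      show "Ck_on k S (\<lambda>x. ?g' (f x) b)"
        using Suc.prems Ck_on_Suc_imp by (intro Suc.IH[of "\<lambda>y. ?g' y b"]) auto
    qed auto
  qed
qed

text \<open>The derivative is again polynomial in the inverse, so the class of the inverse improves by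
  induction.\<close>

lemma Ck_on_inverse:
  "Ck_on k (-{0}) (inverse :: 'a \<Rightarrow> 'a::{real_normed_div_algebra,euclidean_space})"
proof (induction k)
  case 0
  then show ?case by (auto intro: continuous_on_inverse continuous_on_id)
next
  case (Suc k)
  show ?case
    by (rule Ck_on_SucI[where f' = "\<lambda>x v. - (inverse x * v * inverse x)"])
      (auto intro!: has_derivative_inverse' Ck_on_bounded_linear[OF bounded_linear_minus[OF bounded_linear_ident]]
        Ck_on_bounded_bilinear[OF bounded_bilinear_mult] Ck_on_const Suc)
qed

text \<open>The derivative \<open>v / (2 sqrt x)\<close> is a function of the square root itself, which makes the
  induction work.\<close>

lemma Ck_on_sqrt: "Ck_on k {0<..} sqrt"
proof (induction k)
  case 0
  then show ?case by (auto intro: continuous_intros)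
next
  case (Suc k)
  have "((sqrt has_derivative (\<lambda>v. v * (inverse (sqrt x) / 2))) (at x))" if "0 < x" for x
    by (rule has_derivative_eq_rhs[OF DERIV_real_sqrt[OF that, unfolded has_field_derivative_def]])
      (simp add: fun_eq_iff)
  moreover have "Ck_on k {0<..} (\<lambda>x. v * (inverse (sqrt x) / 2))" for v
  proof (rule Ck_on_bounded_linear[where h = "\<lambda>y. v * (y / 2)"])
    show "bounded_linear (\<lambda>y. v * (y / 2))"
      using bounded_linear_mult_right[of "v / 2"] by simp
    show "Ck_on k {0<..} (\<lambda>x. inverse (sqrt x))"
      by (rule Ck_on_compose[where T = "-{0}" and g = inverse and f = sqrt])
        (auto simp: Suc Ck_on_inverse)
  qed auto
  ultimately show ?case by (intro Ck_on_SucI[where f' = "\<lambda>x v. v * (inverse (sqrt x) / 2)"]) auto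
qed

named_theorems smooth_intros

lemma smooth_on_cong: "open S \<Longrightarrow> (\<And>x. x \<in> S \<Longrightarrow> f x = g x) \<Longrightarrow> smooth_on S f \<Longrightarrow> smooth_on S g"
  using Ck_on_cong unfolding smooth_on_def by blast

lemma smooth_on_const [smooth_intros]: "open S \<Longrightarrow> smooth_on S (\<lambda>x. c)"
  by (simp add: smooth_on_def Ck_on_const)

lemma smooth_on_ident [smooth_intros]: "open S \<Longrightarrow> smooth_on S (\<lambda>x. x)"
  by (simp add: smooth_on_def Ck_on_ident)

lemma smooth_on_bounded_linear:
  "bounded_linear h \<Longrightarrow> open S \<Longrightarrow> smooth_on S f \<Longrightarrow> smooth_on S (\<lambda>x. h (f x))"
  by (simp add: smooth_on_def Ck_on_bounded_linear)

lemma smooth_on_bounded_bilinear: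
  "bounded_bilinear pr \<Longrightarrow> open S \<Longrightarrow> smooth_on S f \<Longrightarrow> smooth_on S g \<Longrightarrow> smooth_on S (\<lambda>x. pr (f x) (g x))"
  by (simp add: smooth_on_def Ck_on_bounded_bilinear)

lemma smooth_on_add [smooth_intros]:
  "open S \<Longrightarrow> smooth_on S f \<Longrightarrow> smooth_on S g \<Longrightarrow> smooth_on S (\<lambda>x. f x + g x)"
  by (simp add: smooth_on_def Ck_on_add)

lemma smooth_on_diff [smooth_intros]:
  "open S \<Longrightarrow> smooth_on S f \<Longrightarrow> smooth_on S g \<Longrightarrow> smooth_on S (\<lambda>x. f x - g x)"
  using smooth_on_add[of S f "\<lambda>x. - g x"]
    smooth_on_bounded_linear[OF bounded_linear_minus[OF bounded_linear_ident], of S g] by simp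

lemma smooth_on_compose:
  "open S \<Longrightarrow> open T \<Longrightarrow> f ` S \<subseteq> T \<Longrightarrow> smooth_on S f \<Longrightarrow> smooth_on T g \<Longrightarrow> smooth_on S (\<lambda>x. g (f x))"
  unfolding smooth_on_def using Ck_on_compose by blast

lemmas smooth_on_linear [smooth_intros] =
  smooth_on_bounded_linear[OF bounded_linear_minus[OF bounded_linear_ident]]
  smooth_on_bounded_linear[OF bounded_linear_Re]
  smooth_on_bounded_linear[OF bounded_linear_Im]
  smooth_on_bounded_linear[OF bounded_linear_cnj]
  smooth_on_bounded_linear[OF bounded_linear_of_real]
  smooth_on_bounded_linear[OF bounded_linear_vec_nth]

lemmas smooth_on_bilinear [smooth_intros] =
  smooth_on_bounded_bilinear[OF bounded_bilinear_mult]
  smooth_on_bounded_bilinear[OF bounded_bilinear_scaleR]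

lemma smooth_on_power2_norm [smooth_intros]:
  "open S \<Longrightarrow> smooth_on S f \<Longrightarrow> smooth_on S (\<lambda>x. (norm (f x))\<^sup>2)"
  using smooth_on_bounded_bilinear[OF bounded_bilinear_inner, of S f f]
  by (simp add: power2_norm_eq_inner)

lemma smooth_on_divide [smooth_intros]:
  fixes f g :: "_ \<Rightarrow> 'a::{real_normed_field,euclidean_space}"
  assumes "open S" "smooth_on S f" "smooth_on S g" "\<And>x. x \<in> S \<Longrightarrow> g x \<noteq> 0"
  shows "smooth_on S (\<lambda>x. f x / g x)"
proof -
  have "smooth_on (-{0}) (inverse :: 'a \<Rightarrow> 'a)"
    by (simp add: smooth_on_def Ck_on_inverse)
  then have "smooth_on S (\<lambda>x. inverse (g x))"
    by (rule smooth_on_compose[rotated -1]) (use assms in auto)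
  then have "smooth_on S (\<lambda>x. f x * inverse (g x))"
    using assms by (intro smooth_intros)
  then show ?thesis by (simp add: divide_inverse)
qed

lemma smooth_on_sqrt [smooth_intros]:
  assumes "open S" "smooth_on S f" "\<And>x. x \<in> S \<Longrightarrow> 0 < f x"
  shows "smooth_on S (\<lambda>x. sqrt (f x))"
proof (rule smooth_on_compose[where T = "{0<..}" and g = sqrt])
  show "smooth_on {0<..} sqrt" by (simp add: smooth_on_def Ck_on_sqrt)
qed (use assms in auto)

lemma bounded_linear_axis: "bounded_linear (axis i :: complex \<Rightarrow> complex^'n)"
  by (intro linear_conv_bounded_linear[THEN iffD1] linearI) (auto simp: vec_eq_iff axis_def)

lemma vector_2_axis: "(vector [a, b] :: complex^2) = axis 1 a + axis 2 b"
  by (simp add: vec_eq_iff forall_2 axis_def)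

lemma vector_3_axis: "(vector [a, b, c] :: complex^3) = axis 1 a + axis 2 b + axis 3 c"
  by (simp add: vec_eq_iff forall_3 axis_def)

lemma smooth_on_vector [smooth_intros]:
  "open S \<Longrightarrow> smooth_on S f \<Longrightarrow> smooth_on S g \<Longrightarrow> smooth_on S (\<lambda>x. vector [f x, g x] :: complex^2)"
  "open S \<Longrightarrow> smooth_on S f \<Longrightarrow> smooth_on S g \<Longrightarrow> smooth_on S h
     \<Longrightarrow> smooth_on S (\<lambda>x. vector [f x, g x, h x] :: complex^3)"
  by (auto simp: vector_2_axis vector_3_axis intro!: smooth_on_bounded_linear[OF bounded_linear_axis] smooth_on_add)

lemma smooth_on_has_derivative:
  "smooth_on S f \<Longrightarrow> x \<in> S \<Longrightarrow> (f has_derivative frechet_derivative f (at x)) (at x)"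
  unfolding smooth_on_def using Ck_on_Suc_has_derivative by blast

lemma smooth_on_imp_continuous_on: "smooth_on S f \<Longrightarrow> continuous_on S f"
  unfolding smooth_on_def using Ck_on.simps(1) by blast

lemma smooth_on_subset: "smooth_on T f \<Longrightarrow> S \<subseteq> T \<Longrightarrow> smooth_on S f"
proof -
  have "Ck_on k T f \<Longrightarrow> S \<subseteq> T \<Longrightarrow> Ck_on k S f" for k
    by (induction k arbitrary: f) (auto intro: continuous_on_subset)
  then show "smooth_on T f \<Longrightarrow> S \<subseteq> T \<Longrightarrow> smooth_on S f" unfolding smooth_on_def by blast
qed

section \<open>Charts of embedded submanifolds\<close>

text \<open>A chart is certified by an explicit smooth inverse \<open>\<psi>\<close> and a differentiable function \<open>F\<close> on
  the ambient space that agrees with the chart on its domain: \<open>F \<circ> \<psi> = id\<close> makes the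
  differential of \<open>\<psi>\<close> injective.\<close>

lemma smooth_chartI:
  fixes M :: "'a::euclidean_space set" and \<phi> F :: "'a \<Rightarrow> 'b::euclidean_space"
  assumes "openin (top_of_set M) U" "open D" "smooth_on D \<psi>" "\<psi> ` D \<subseteq> U" "\<phi> ` U \<subseteq> D"
    and left: "\<And>x. x \<in> U \<Longrightarrow> \<psi> (\<phi> x) = x" and right: "\<And>y. y \<in> D \<Longrightarrow> \<phi> (\<psi> y) = y"
    and F: "\<And>x. x \<in> U \<Longrightarrow> F x = \<phi> x" "\<And>x. x \<in> U \<Longrightarrow> F differentiable (at x)"
  shows "smooth_chart M U \<phi>"
proof -
  have D: "\<phi> ` U = D" using assms(4,5) right by force
  have "continuous_on U F"
    using F(2) by (auto intro: continuous_at_imp_continuous_on differentiable_imp_continuous_within)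
  then have "continuous_on U \<phi>" using F(1) by (simp cong: continuous_on_cong)
  moreover have "\<psi> ` D = U"
  proof (intro equalityI assms(4) subsetI)
    fix x assume "x \<in> U"
    then show "x \<in> \<psi> ` D" using left assms(5) by (metis image_eqI image_subset_iff)
  qed
  ultimately have "homeomorphism U D \<phi> \<psi>"
    unfolding homeomorphism_def using D left right smooth_on_imp_continuous_on[OF assms(3)] by blast
  moreover have "inj (frechet_derivative \<psi> (at y))" if "y \<in> D" for y
  proof -
    have y: "\<psi> y \<in> U" using that assms(4) by blast
    then obtain F' where F': "(F has_derivative F') (at (\<psi> y))"
      using F(2) unfolding differentiable_def by blast
    have "((\<lambda>y. F (\<psi> y)) has_derivative (\<lambda>v. F' (frechet_derivative \<psi> (at y) v))) (at y)"
      using has_derivative_compose[OF smooth_on_has_derivative[OF assms(3) that] F'] .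
    moreover have "((\<lambda>y. F (\<psi> y)) has_derivative (\<lambda>v. v)) (at y)"
      by (rule has_derivative_transform_within_open[OF has_derivative_ident assms(2) that])
        (use assms(4) F(1) right in force)
    ultimately have "(\<lambda>v. F' (frechet_derivative \<psi> (at y) v)) = (\<lambda>v. v)"
      by (rule has_derivative_unique)
    then show ?thesis by (metis injI)
  qed
  ultimately show ?thesis
    unfolding smooth_chart_def D using assms(1-3) by blast
qed

text \<open>The inverse in the definition of a chart can be taken to be \<open>inv_into\<close>, the inverse that
  enters the operators of a complex structure.\<close>

lemma smooth_chart_inverse:
  assumes "smooth_chart M U \<phi>"
  shows "open (\<phi> ` U)" "openin (top_of_set M) U" "U \<subseteq> M"
    "homeomorphism U (\<phi> ` U) \<phi> (inv_into U \<phi>)" "inj_on \<phi> U"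
    "smooth_on (\<phi> ` U) (inv_into U \<phi>)"
    "\<And>y. y \<in> \<phi> ` U \<Longrightarrow> inj (frechet_derivative (inv_into U \<phi>) (at y))"
proof -
  obtain \<psi> where \<psi>: "homeomorphism U (\<phi> ` U) \<phi> \<psi>" "smooth_on (\<phi> ` U) \<psi>"
    "\<forall>y\<in>\<phi> ` U. inj (frechet_derivative \<psi> (at y))"
    and o: "open (\<phi> ` U)" and U: "openin (top_of_set M) U"
    using assms unfolding smooth_chart_def by blast
  from o U show "open (\<phi> ` U)" "openin (top_of_set M) U" "U \<subseteq> M"
    by (auto dest: openin_imp_subset)
  show inj: "inj_on \<phi> U" using \<psi>(1) by (metis homeomorphism_apply1 inj_onI)
  have eq: "\<psi> y = inv_into U \<phi> y" if "y \<in> \<phi> ` U" for y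
    using that homeomorphism_apply1[OF \<psi>(1)] inj by auto
  show "homeomorphism U (\<phi> ` U) \<phi> (inv_into U \<phi>)"
    using \<psi>(1) eq by (elim homeomorphism_cong) auto
  show "smooth_on (\<phi> ` U) (inv_into U \<phi>)"
    using smooth_on_cong[OF o eq \<psi>(2)] .
  show "inj (frechet_derivative (inv_into U \<phi>) (at y))" if "y \<in> \<phi> ` U" for y
  proof -
    have "frechet_derivative \<psi> (at y) = frechet_derivative (inv_into U \<phi>) (at y)"
      by (rule frechet_derivative_cong_open[OF o that eq])
    then show ?thesis using \<psi>(3) that by metis
  qed
qed

abbreviation inv_chart_deriv :: "'a::euclidean_space set \<Rightarrow> ('a \<Rightarrow> 'b::euclidean_space) \<Rightarrow> 'a \<Rightarrow> 'b \<Rightarrow> 'a"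
  where "inv_chart_deriv U \<phi> p \<equiv> frechet_derivative (inv_into U \<phi>) (at (\<phi> p))"

lemma inv_chart_has_derivative:
  assumes "smooth_chart M U \<phi>" "p \<in> U"
  shows "(inv_into U \<phi> has_derivative inv_chart_deriv U \<phi> p) (at (\<phi> p))"
  using smooth_on_has_derivative[OF smooth_chart_inverse(6)[OF assms(1)]] assms(2) by simp

text \<open>Differentiate \<open>F \<circ> \<psi> = id\<close>, where \<open>\<psi>\<close> is the inverse of the chart. Only the values of the
  chart on \<open>M\<close> carry meaning, so \<open>F\<close> takes its place in the chain rule.\<close>

lemma chart_deriv_left_inverse:
  assumes ch: "smooth_chart M U \<phi>" and p: "p \<in> U"
    and F: "\<And>x. x \<in> U \<Longrightarrow> F x = \<phi> x" and F': "(F has_derivative F') (at p)"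
  shows "F' (inv_chart_deriv U \<phi> p \<xi>) = \<xi>"
proof -
  note c = smooth_chart_inverse[OF ch]
  let ?\<psi> = "inv_into U \<phi>"
  have "?\<psi> (\<phi> p) = p" using c(5) p by simp
  then have "((\<lambda>y. F (?\<psi> y)) has_derivative (\<lambda>v. F' (inv_chart_deriv U \<phi> p v))) (at (\<phi> p))"
    using has_derivative_compose[OF inv_chart_has_derivative[OF ch p], of F F'] F' by simp
  moreover have "((\<lambda>y. F (?\<psi> y)) has_derivative (\<lambda>v. v)) (at (\<phi> p))"
    by (rule has_derivative_transform_within_open[OF has_derivative_ident c(1)])
      (use p F c(5) in auto)
  ultimately have "(\<lambda>v. F' (inv_chart_deriv U \<phi> p v)) = (\<lambda>v. v)"
    by (rule has_derivative_unique)
  then show ?thesis by meson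
qed

text \<open>A curve in \<open>M\<close> satisfies \<open>\<gamma> = \<psi> \<circ> F \<circ> \<gamma>\<close> near its base point, so its velocity is an image
  under the differential of \<open>\<psi>\<close>; conversely \<open>\<psi>\<close> maps line segments to curves in \<open>M\<close>.\<close>

lemma tangent_space_chart:
  fixes M :: "'a::euclidean_space set" and \<phi> F :: "'a \<Rightarrow> 'b::euclidean_space"
  assumes ch: "smooth_chart M U \<phi>" and p: "p \<in> U"
    and F: "\<And>x. x \<in> U \<Longrightarrow> F x = \<phi> x" and F': "(F has_derivative F') (at p)"
  shows "tangent_space M p = range (inv_chart_deriv U \<phi> p)"
proof (intro equalityI subsetI)
  note c = smooth_chart_inverse[OF ch]
  let ?\<psi> = "inv_into U \<phi>"
  have \<psi>p: "?\<psi> (\<phi> p) = p" using c(5) p by simp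
  obtain W where W: "open W" "U = M \<inter> W" using c(2) by (auto simp: openin_open)
  {
    fix v assume "v \<in> tangent_space M p"
    then obtain \<epsilon> \<gamma> where \<gamma>: "0 < \<epsilon>" "smooth_on {-\<epsilon><..<\<epsilon>} \<gamma>" "\<gamma> ` {-\<epsilon><..<\<epsilon>} \<subseteq> M"
      "\<gamma> (0::real) = p" "(\<gamma> has_vector_derivative v) (at 0)"
      unfolding tangent_space_def by blast
    define N where "N = {-\<epsilon><..<\<epsilon>} \<inter> \<gamma> -` W"
    have N: "open N" "0 \<in> N"
      unfolding N_def using \<gamma>(1,4) p W
      by (auto intro!: continuous_open_preimage smooth_on_imp_continuous_on \<gamma>(2))
    have NU: "\<gamma> t \<in> U" if "t \<in> N" for t
      using that \<gamma>(3) W unfolding N_def by auto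
    have "(\<gamma> has_derivative (\<lambda>t. t *\<^sub>R v)) (at 0)"
      using \<gamma>(5) by (simp add: has_vector_derivative_def)
    then have F\<gamma>: "((\<lambda>t. F (\<gamma> t)) has_derivative (\<lambda>t. F' (t *\<^sub>R v))) (at 0)"
      by (rule has_derivative_compose) (use \<gamma>(4) F' in simp)
    have "((\<lambda>t. ?\<psi> (F (\<gamma> t))) has_derivative (\<lambda>t. inv_chart_deriv U \<phi> p (F' (t *\<^sub>R v)))) (at 0)"
      by (rule has_derivative_compose[OF F\<gamma>])
        (use inv_chart_has_derivative[OF ch p] F[OF p] \<gamma>(4) in simp)
    then have "(\<gamma> has_derivative (\<lambda>t. inv_chart_deriv U \<phi> p (F' (t *\<^sub>R v)))) (at 0)"
      by (rule has_derivative_transform_within_open[OF _ N])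
        (use NU F c(5) in simp)
    then have "(\<lambda>t. t *\<^sub>R v) = (\<lambda>t. inv_chart_deriv U \<phi> p (F' (t *\<^sub>R v)))"
      using \<gamma>(5) has_derivative_unique unfolding has_vector_derivative_def by blast
    then have "v = inv_chart_deriv U \<phi> p (F' v)" by (metis scaleR_one)
    then show "v \<in> range (inv_chart_deriv U \<phi> p)" by blast
  }
  fix v assume "v \<in> range (inv_chart_deriv U \<phi> p)"
  then obtain \<xi> where v: "v = inv_chart_deriv U \<phi> p \<xi>" by blast
  define l where "l = (\<lambda>t::real. \<phi> p + t *\<^sub>R \<xi>)"
  have "open (l -` (\<phi> ` U))"
    unfolding l_def by (intro open_vimage c(1) continuous_intros)
  moreover have "0 \<in> l -` (\<phi> ` U)" using p by (simp add: l_def)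
  ultimately obtain \<epsilon> where \<epsilon>: "0 < \<epsilon>" "cball 0 \<epsilon> \<subseteq> l -` (\<phi> ` U)"
    using open_contains_cball by blast
  then have l: "l ` {-\<epsilon><..<\<epsilon>} \<subseteq> \<phi> ` U" by (force simp: subset_iff)
  have "smooth_on {-\<epsilon><..<\<epsilon>} l"
    unfolding l_def by (intro smooth_intros open_greaterThanLessThan)
  then have "smooth_on {-\<epsilon><..<\<epsilon>} (\<lambda>t. ?\<psi> (l t))"
    using l c(1,6) smooth_on_compose open_greaterThanLessThan by blast
  moreover have "(\<lambda>t. ?\<psi> (l t)) ` {-\<epsilon><..<\<epsilon>} \<subseteq> M"
    using l c(3) by (force intro: inv_into_into)
  moreover have "((\<lambda>t. ?\<psi> (l t)) has_vector_derivative v) (at 0)"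
  proof -
    have l': "(l has_derivative (\<lambda>t. t *\<^sub>R \<xi>)) (at 0)"
      unfolding l_def by (auto intro!: derivative_eq_intros)
    have "((\<lambda>t. ?\<psi> (l t)) has_derivative (\<lambda>t. inv_chart_deriv U \<phi> p (t *\<^sub>R \<xi>))) (at 0)"
      by (rule has_derivative_compose[OF l'])
        (use inv_chart_has_derivative[OF ch p] in \<open>simp add: l_def\<close>)
    then show ?thesis
      unfolding has_vector_derivative_def v
      by (simp add: linear_cmul[OF has_derivative_linear[OF inv_chart_has_derivative[OF ch p]]])
  qed
  ultimately show "v \<in> tangent_space M p"
    unfolding tangent_space_def using \<epsilon>(1) \<psi>p
    by (intro CollectI exI[of _ \<epsilon>] exI[of _ "\<lambda>t. ?\<psi> (l t)"]) (simp add: l_def)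
qed

lemma inj_on_tangent_space:
  assumes ch: "smooth_chart M U \<phi>" and p: "p \<in> U"
    and F: "\<And>x. x \<in> U \<Longrightarrow> F x = \<phi> x" and F': "(F has_derivative F') (at p)"
  shows "inj_on F' (tangent_space M p)"
  using tangent_space_chart[OF assms] chart_deriv_left_inverse[OF assms] by (auto simp: inj_on_def)

lemma tangent_space_local:
  assumes "open W" "p \<in> W"
  shows "tangent_space (M \<inter> W) p = tangent_space M p"
proof (intro equalityI subsetI)
  fix v assume "v \<in> tangent_space (M \<inter> W) p"
  then show "v \<in> tangent_space M p" unfolding tangent_space_def by blast
next
  fix v assume "v \<in> tangent_space M p"
  then obtain \<epsilon> \<gamma> where \<gamma>: "0 < \<epsilon>" "smooth_on {-\<epsilon><..<\<epsilon>} \<gamma>" "\<gamma> ` {-\<epsilon><..<\<epsilon>} \<subseteq> M"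
    "\<gamma> (0::real) = p" "(\<gamma> has_vector_derivative v) (at 0)"
    unfolding tangent_space_def by blast
  have "open ({-\<epsilon><..<\<epsilon>} \<inter> \<gamma> -` W)" "0 \<in> {-\<epsilon><..<\<epsilon>} \<inter> \<gamma> -` W"
    using \<gamma>(1,4) assms by (auto intro!: continuous_open_preimage smooth_on_imp_continuous_on \<gamma>(2))
  then obtain d where d: "0 < d" "cball 0 d \<subseteq> {-\<epsilon><..<\<epsilon>} \<inter> \<gamma> -` W"
    using open_contains_cball by blast
  have "{-d<..<d} \<subseteq> cball 0 d" by auto
  with d(2) have sub: "{-d<..<d} \<subseteq> {-\<epsilon><..<\<epsilon>} \<inter> \<gamma> -` W" by blast
  then have "smooth_on {-d<..<d} \<gamma>" "\<gamma> ` {-d<..<d} \<subseteq> M \<inter> W"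
    using \<gamma>(2,3) smooth_on_subset by blast+
  with d(1) \<gamma>(4,5) show "v \<in> tangent_space (M \<inter> W) p"
    unfolding tangent_space_def by blast
qed

text \<open>Serves to pass from charts with values in \<open>\<complex>\<^sup>2\<close> to charts with values in \<open>\<real>\<^sup>4\<close>.\<close>

lemma smooth_chart_linear_iso:
  fixes f :: "'b::euclidean_space \<Rightarrow> 'c::euclidean_space"
  assumes ch: "smooth_chart M U \<phi>" and f: "linear f" "linear g" "\<And>x. g (f x) = x" "\<And>y. f (g y) = y"
  shows "smooth_chart M U (f \<circ> \<phi>)"
proof -
  note c = smooth_chart_inverse[OF ch]
  have bl: "bounded_linear f" "bounded_linear g" using f(1,2) by (simp_all add: linear_conv_bounded_linear)
  have im: "(f \<circ> \<phi>) ` U = g -` (\<phi> ` U)" unfolding image_comp[symmetric]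
    by (auto simp: f(3)) (metis f(4) imageI)
  have o: "open ((f \<circ> \<phi>) ` U)"
    unfolding im using bl(2) by (intro open_vimage c(1)) (simp add: linear_continuous_on)
  have "homeomorphism U ((f \<circ> \<phi>) ` U) (f \<circ> \<phi>) (inv_into U \<phi> \<circ> g)"
  proof (rule homeomorphism_compose[OF c(4)])
    show "homeomorphism (\<phi> ` U) ((f \<circ> \<phi>) ` U) f g"
      using f(3,4) bl unfolding homeomorphism_def
      by (auto simp: linear_continuous_on image_image)
  qed
  moreover have "smooth_on ((f \<circ> \<phi>) ` U) (inv_into U \<phi> \<circ> g)"
  proof -
    have "smooth_on ((f \<circ> \<phi>) ` U) g"
      using smooth_on_bounded_linear[OF bl(2) o smooth_on_ident[OF o]] .
    then show ?thesis
      using smooth_on_compose[OF o c(1) _ _ c(6), of g] f(3) by (auto simp: comp_def)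
  qed
  moreover have "inj (frechet_derivative (inv_into U \<phi> \<circ> g) (at y))" if "y \<in> (f \<circ> \<phi>) ` U" for y
  proof -
    have gy: "g y \<in> \<phi> ` U" using that f(3) by auto
    let ?D = "frechet_derivative (inv_into U \<phi>) (at (g y))"
    have "(inv_into U \<phi> \<circ> g has_derivative ?D \<circ> g) (at y)"
      using diff_chain_at[OF bounded_linear_imp_has_derivative[OF bl(2)]
        smooth_on_has_derivative[OF c(6) gy]] .
    then have "frechet_derivative (inv_into U \<phi> \<circ> g) (at y) = ?D \<circ> g"
      by (rule frechet_derivative_at[symmetric])
    then show ?thesis
      using c(7)[OF gy] f(4) by (metis inj_compose injI)
  qed
  ultimately show ?thesis unfolding smooth_chart_def using c(2) o by blast
qed

lemma smooth_chart_image_Int_open: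
  assumes cU: "smooth_chart M U \<phi>" and cV: "smooth_chart M V \<eta>"
  shows "open (\<eta> ` (V \<inter> U))"
proof -
  note u = smooth_chart_inverse[OF cU] and v = smooth_chart_inverse[OF cV]
  have "openin (top_of_set V) (V \<inter> U)"
  proof -
    obtain W where "open W" "U = M \<inter> W" using u(2) by (auto simp: openin_open)
    then have "V \<inter> U = V \<inter> W" using v(3) by blast
    with \<open>open W\<close> show ?thesis by (simp add: openin_open_Int)
  qed
  then have "openin (top_of_set (\<eta> ` V)) (\<eta> ` (V \<inter> U))"
    using v(4) homeomorphism_imp_open_map by blast
  then show "open (\<eta> ` (V \<inter> U))" using v(1) openin_open_trans by blast
qed

section \<open>Complex structures\<close>

text \<open>Reduces the holomorphy of a transition map to a formula that expresses one chart through the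
  other.\<close>

lemma holomorphic_transitionI:
  assumes cU: "smooth_chart M U \<phi>" and cV: "smooth_chart M V \<eta>"
    and g: "holomorphic_map_on (\<eta> ` (V \<inter> U)) g" "\<And>x. x \<in> V \<inter> U \<Longrightarrow> \<phi> x = g (\<eta> x)"
  shows "holomorphic_map_on (\<eta> ` (V \<inter> U)) (\<phi> \<circ> inv_into V \<eta>)"
  unfolding holomorphic_map_on_def
proof
  note v = smooth_chart_inverse[OF cV]
  have o: "open (\<eta> ` (V \<inter> U))" by (rule smooth_chart_image_Int_open[OF cU cV])
  fix z assume z: "z \<in> \<eta> ` (V \<inter> U)"
  then obtain g' where g': "(g has_derivative g') (at z)" "\<forall>c v. g' (c *s v) = c *s g' v"
    using g(1) unfolding holomorphic_map_on_def by blast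
  have "(\<phi> \<circ> inv_into V \<eta> has_derivative g') (at z)"
    by (rule has_derivative_transform_within_open[OF g'(1) o z]) (use v(5) g(2) in auto)
  with g'(2) show "\<exists>f'. (\<phi> \<circ> inv_into V \<eta> has_derivative f') (at z) \<and> (\<forall>c v. f' (c *s v) = c *s f' v)"
    by blast
qed

lemma holomorphic_map_on_ident: "holomorphic_map_on S (\<lambda>z. z)"
  unfolding holomorphic_map_on_def by (blast intro: has_derivative_ident)

lemma complex_structure_real_four_manifold:
  assumes "complex_structure M A"
  shows "real_four_manifold M"
  unfolding real_four_manifold_def
proof
  fix p assume "p \<in> M"
  with assms obtain U \<phi> where U: "(U, \<phi>) \<in> A" "p \<in> U" "smooth_chart M U \<phi>"
    unfolding complex_structure_def by blast
  obtain f :: "complex^2 \<Rightarrow> real^4" and g where "linear f" "linear g" "\<And>x. g (f x) = x" "\<And>y. f (g y) = y"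
  proof -
    have "DIM(complex^2) = DIM(real^4)" by simp
    from isomorphisms_UNIV_UNIV[OF this] that show ?thesis by metis
  qed
  then have "smooth_chart M U (f \<circ> \<phi>)" using smooth_chart_linear_iso U(3) by blast
  with U(2) show "\<exists>U (\<phi> :: 'a \<Rightarrow> real^4). p \<in> U \<and> smooth_chart M U \<phi>" by blast
qed

lemma complex_structure_transition_deriv:
  assumes A: "complex_structure M A" and U: "(U, \<phi>) \<in> A" "p \<in> U" and V: "(V, \<eta>) \<in> A" "p \<in> V"
  obtains \<tau>' where "inv_chart_deriv V \<eta> p = inv_chart_deriv U \<phi> p \<circ> \<tau>'" "\<And>c v. \<tau>' (c *s v) = c *s \<tau>' v"
proof -
  have cU: "smooth_chart M U \<phi>" and cV: "smooth_chart M V \<eta>"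
    and hol: "holomorphic_map_on (\<eta> ` (V \<inter> U)) (\<phi> \<circ> inv_into V \<eta>)"
    using A U V unfolding complex_structure_def by blast+
  note u = smooth_chart_inverse[OF cU] and v = smooth_chart_inverse[OF cV]
  have p: "\<eta> p \<in> \<eta> ` (V \<inter> U)" "inv_into V \<eta> (\<eta> p) = p" using U(2) V(2) v(5) by auto
  then obtain \<tau>' where \<tau>: "(\<phi> \<circ> inv_into V \<eta> has_derivative \<tau>') (at (\<eta> p))"
    "\<And>c v. \<tau>' (c *s v) = c *s \<tau>' v"
    using hol unfolding holomorphic_map_on_def by blast
  have o: "open (\<eta> ` (V \<inter> U))" by (rule smooth_chart_image_Int_open[OF cU cV])
  have "(inv_into U \<phi> \<circ> (\<phi> \<circ> inv_into V \<eta>) has_derivative inv_chart_deriv U \<phi> p \<circ> \<tau>') (at (\<eta> p))"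
    by (rule diff_chain_at[OF \<tau>(1)]) (use inv_chart_has_derivative[OF cU U(2)] p in simp)
  then have "(inv_into V \<eta> has_derivative inv_chart_deriv U \<phi> p \<circ> \<tau>') (at (\<eta> p))"
    by (rule has_derivative_transform_within_open[OF _ o p(1)]) (use u(5) v(5) in auto)
  then have "inv_chart_deriv V \<eta> p = inv_chart_deriv U \<phi> p \<circ> \<tau>'"
    using frechet_derivative_at by metis
  with \<tau>(2) that show thesis by blast
qed

text \<open>The differential of the inverse of another chart is \<open>inv_chart_deriv U \<phi> p\<close> composed with a
  complex linear map, which commutes with \<open>\<i>\<close>; so all charts prescribe the same vector in the
  definition of \<open>cstr_op\<close>.\<close>

lemma cstr_op_chart:
  assumes A: "complex_structure M A" and U: "(U, \<phi>) \<in> A" "p \<in> U"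
  shows "cstr_op A p (inv_chart_deriv U \<phi> p \<xi>) = inv_chart_deriv U \<phi> p (\<i> *s \<xi>)"
  unfolding cstr_op_def
proof (rule the_equality)
  show "\<exists>(V, \<eta>)\<in>A. p \<in> V \<and> (\<exists>\<zeta>. inv_chart_deriv U \<phi> p \<xi> = inv_chart_deriv V \<eta> p \<zeta> \<and>
      inv_chart_deriv U \<phi> p (\<i> *s \<xi>) = inv_chart_deriv V \<eta> p (\<i> *s \<zeta>))"
    using U by blast
next
  fix w
  assume "\<exists>(V, \<eta>)\<in>A. p \<in> V \<and> (\<exists>\<zeta>. inv_chart_deriv U \<phi> p \<xi> = inv_chart_deriv V \<eta> p \<zeta> \<and>
      w = inv_chart_deriv V \<eta> p (\<i> *s \<zeta>))"
  then obtain V \<eta> \<zeta> where V: "(V, \<eta>) \<in> A" "p \<in> V"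
    and \<zeta>: "inv_chart_deriv U \<phi> p \<xi> = inv_chart_deriv V \<eta> p \<zeta>" "w = inv_chart_deriv V \<eta> p (\<i> *s \<zeta>)"
    by blast
  from complex_structure_transition_deriv[OF A U V] obtain \<tau>' where
    \<tau>: "inv_chart_deriv V \<eta> p = inv_chart_deriv U \<phi> p \<circ> \<tau>'" "\<And>c v. \<tau>' (c *s v) = c *s \<tau>' v"
    by blast
  have "inj (inv_chart_deriv U \<phi> p)"
    using A U smooth_chart_inverse(7) unfolding complex_structure_def by blast
  then have "\<xi> = \<tau>' \<zeta>" using \<zeta>(1) \<tau>(1) by (simp add: inj_eq)
  with \<zeta>(2) \<tau> show "w = inv_chart_deriv U \<phi> p (\<i> *s \<xi>)" by simp
qed

text \<open>Characterises the operator without inverse charts: a tangent vector is determined by its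
  image under \<open>F'\<close>.\<close>

lemma cstr_op_extension:
  assumes A: "complex_structure M A" and U: "(U, \<phi>) \<in> A" "p \<in> U"
    and F: "\<And>x. x \<in> U \<Longrightarrow> F x = \<phi> x" and F': "(F has_derivative F') (at p)"
    and X: "X \<in> tangent_space M p"
  shows "cstr_op A p X \<in> tangent_space M p" "F' (cstr_op A p X) = \<i> *s F' X"
proof -
  have ch: "smooth_chart M U \<phi>" using A U(1) unfolding complex_structure_def by blast
  have T: "tangent_space M p = range (inv_chart_deriv U \<phi> p)"
    by (rule tangent_space_chart[OF ch U(2) F F'])
  then obtain \<xi> where \<xi>: "X = inv_chart_deriv U \<phi> p \<xi>" using X by blast
  then have *: "cstr_op A p X = inv_chart_deriv U \<phi> p (\<i> *s \<xi>)"
    using cstr_op_chart[OF A U] by simp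
  then show "cstr_op A p X \<in> tangent_space M p" unfolding T by blast
  show "F' (cstr_op A p X) = \<i> *s F' X"
  proof -
    have "F' (inv_chart_deriv U \<phi> p \<zeta>) = \<zeta>" for \<zeta>
      by (rule chart_deriv_left_inverse[OF ch U(2) F F'])
    then show ?thesis unfolding * unfolding \<xi> by simp
  qed
qed

text \<open>If the chart extends to a function whose differential commutes with \<open>\<i>\<close>, then \<open>\<i> *s X\<close> and
  the transported multiplication have the same image under \<open>F'\<close>, which is injective on tangent
  vectors.\<close>

lemma cstr_op_eq_ambient:
  fixes M :: "(complex^'n) set"
  assumes A: "complex_structure M A" and U: "(U, \<phi>) \<in> A" "p \<in> U"
    and F: "\<And>x. x \<in> U \<Longrightarrow> F x = \<phi> x" and F': "(F has_derivative F') (at p)"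
    and lin: "\<And>v. F' (\<i> *s v) = \<i> *s F' v"
    and X: "X \<in> tangent_space M p" "\<i> *s X \<in> tangent_space M p"
  shows "cstr_op A p X = \<i> *s X"
proof -
  have ch: "smooth_chart M U \<phi>" using A U(1) unfolding complex_structure_def by blast
  show ?thesis
    using inj_on_tangent_space[OF ch U(2) F F'] cstr_op_extension[OF A U F F' X(1)] X(2) lin
    by (simp add: inj_on_def)
qed

section \<open>Complex lines of common tangent vectors\<close>

text \<open>Multiplying by the conjugate of \<open>c\<close> turns \<open>c v = 0\<close> into \<open>\<bar>c\<bar>\<^sup>2 v = 0\<close>.\<close>

lemma cscale_eq_0_iff: "cscale c v = 0 \<longleftrightarrow> c = 0 \<or> v = 0"
proof
  obtain a b where v: "v = (a, b)" by (cases v)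
  assume "cscale c v = 0"
  then have 1: "Re c *\<^sub>R a = Im c *\<^sub>R b" and 2: "Im c *\<^sub>R a = - (Re c *\<^sub>R b)"
    by (auto simp: cscale_def v prod_eq_iff add_eq_0_iff)
  have "((Re c)\<^sup>2 + (Im c)\<^sup>2) *\<^sub>R a = Re c *\<^sub>R (Re c *\<^sub>R a) + Im c *\<^sub>R (Im c *\<^sub>R a)"
    by (simp add: power2_eq_square algebra_simps)
  also have "\<dots> = 0" unfolding 1 2 by (simp add: mult.commute)
  moreover have "((Re c)\<^sup>2 + (Im c)\<^sup>2) *\<^sub>R b = Im c *\<^sub>R (Im c *\<^sub>R b) - Re c *\<^sub>R (- (Re c *\<^sub>R b))"
    by (simp add: power2_eq_square algebra_simps)
  moreover have "\<dots> = 0" unfolding 1[symmetric] 2[symmetric] by (simp add: mult.commute)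
  ultimately show "c = 0 \<or> v = 0"
    by (simp add: v complex_eq_iff sum_power2_eq_zero_iff zero_prod_def) metis
qed (auto simp: cscale_def zero_prod_def split: prod.splits)

lemma cscale_cscale: "cscale c (cscale d v) = cscale (c * d) v"
  by (cases v) (simp add: cscale_def algebra_simps)

lemma cspan_fam_1: "cspan_fam 1 s = {cscale c (s 0) | c. True}"
  unfolding cspan_fam_def by (auto intro: exI[of _ "\<lambda>_. _"])

lemma cindep_fam_1: "cindep_fam 1 s \<longleftrightarrow> s 0 \<noteq> 0"
  unfolding cindep_fam_def by (auto simp: cscale_eq_0_iff dest: spec[of _ "\<lambda>_. 1"])

lemma cscale_0: "cscale 0 v = 0"
  by (simp add: cscale_eq_0_iff)

text \<open>Puts the multiples of the first frame vector in the form that \<open>cspan_fam\<close> and \<open>cindep_fam\<close>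
  speak of.\<close>

lemma cscale_first_eq_sum:
  assumes "1 \<le> k"
  shows "cscale c (s 0) = (\<Sum>i<(k::nat). cscale (if i = 0 then c else 0) (s i))"
proof -
  have "(\<Sum>i<k. cscale (if i = 0 then c else 0) (s i)) = (\<Sum>i<k. if i = 0 then cscale c (s i) else 0)"
    by (rule sum.cong) (auto simp: cscale_0)
  also have "\<dots> = cscale c (s 0)" using assms by (subst sum.delta) auto
  finally show ?thesis ..
qed

text \<open>A complex line has no proper non-zero subspace.\<close>

lemma cspan_fam_in_line:
  assumes k: "1 \<le> k" and ind: "cindep_fam k s" and sub: "cspan_fam k s \<subseteq> {cscale c v | c. True}"
  shows "cspan_fam k s = {cscale c v | c. True}"
proof (intro equalityI sub subsetI)
  have mem: "cscale c (s 0) \<in> cspan_fam k s" for c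
    unfolding cspan_fam_def cscale_first_eq_sum[OF k, of c s]
    by (intro CollectI exI[of _ "\<lambda>i. if i = 0 then c else 0"]) simp
  obtain d where d: "cscale 1 (s 0) = cscale d v" using mem[of 1] sub by blast
  have "cscale 1 (s 0) \<noteq> 0"
    using ind k unfolding cindep_fam_def cscale_first_eq_sum[OF k, of 1 s] by force
  then have "d \<noteq> 0" using d by (auto simp: cscale_0)
  fix w assume "w \<in> {cscale c v | c. True}"
  then obtain c where "w = cscale c v" by blast
  also have "\<dots> = cscale (c / d) (cscale d v)" using \<open>d \<noteq> 0\<close> by (simp add: cscale_cscale)
  also have "\<dots> = cscale (c / d) (s 0)" unfolding d[symmetric] by (simp add: cscale_cscale)
  finally show "w \<in> cspan_fam k s" using mem by simp
qed

text \<open>Where the common \<open>(1,0)\<close>-vectors form a line bundle with a smooth nowhere vanishing section,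
  that bundle is compatible, and a compatible bundle of positive rank cannot be smaller than
  it.\<close>

lemma psc_bundle_iff:
  assumes s: "smooth_map_on M s" "\<And>p. p \<in> M \<Longrightarrow> s p \<noteq> 0"
    and common: "\<And>p. p \<in> M \<Longrightarrow> T10 M I p \<inter> T10 M J p = {cscale c (s p) | c. True}"
  shows "psc_bundle M I J H \<longleftrightarrow> (\<forall>p\<in>M. H p = {cscale c (s p) | c. True})"
proof -
  let ?L = "\<lambda>p. {cscale c (s p) | c. True}"
  have uniq: "H' p = ?L p" if H': "psc_compatible k M I J H'" and k: "1 \<le> k" and p: "p \<in> M" for k H' p
  proof -
    obtain s' where s': "cindep_fam k s'" "H' p = cspan_fam k s'"
      using H' p unfolding psc_compatible_def complex_subbundle_def by meson
    have "H' p \<subseteq> ?L p"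
      using H' p common[OF p] unfolding psc_compatible_def complex_subbundle_def by blast
    then show ?thesis using cspan_fam_in_line[OF k s'(1)] s'(2) by simp
  qed
  have comp: "psc_compatible 1 M I J H" if H: "\<forall>p\<in>M. H p = ?L p"
    unfolding psc_compatible_def complex_subbundle_def
  proof (intro conjI ballI)
    fix p assume p: "p \<in> M"
    then show "H p \<subseteq> T10 M I p" "H p \<subseteq> T10 M J p" using H common[OF p] by auto
    show "\<exists>U t. openin (top_of_set M) U \<and> p \<in> U \<and> (\<forall>i<1::nat. smooth_map_on U (t i)) \<and>
        (\<forall>q\<in>U. cindep_fam 1 (\<lambda>i. t i q) \<and> H q = cspan_fam 1 (\<lambda>i. t i q))"
      unfolding cindep_fam_1 cspan_fam_1
      using p H s by (intro exI[of _ M] exI[of _ "\<lambda>_. s"]) simp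
  qed
  show ?thesis
  proof (intro iffI)
    assume "psc_bundle M I J H"
    then show "\<forall>p\<in>M. H p = ?L p" using uniq[of 1 H] unfolding psc_bundle_def by blast
  next
    assume H: "\<forall>p\<in>M. H p = ?L p"
    have "H' p = H p" if "psc_compatible k M I J H'" "1 \<le> k" "p \<in> M" for k H' p
      using uniq[OF that] H that(3) by simp
    with comp[OF H] show "psc_bundle M I J H" unfolding psc_bundle_def by blast
  qed
qed

section \<open>Algebra of the cross-ratio variety\<close>

text \<open>The equations of \<open>crvar\<close> for three scalars, so that the algebra below is free of vectors.\<close>

definition cross_ratio_rel :: "complex \<Rightarrow> complex \<Rightarrow> complex \<Rightarrow> bool" where
  "cross_ratio_rel x y z \<longleftrightarrow> x \<noteq> 0 \<and> (cmod z)\<^sup>2 = (cmod y)\<^sup>2 / (cmod x)\<^sup>2 \<and>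
     2 * (cmod x)\<^sup>2 * Re z = (cmod x)\<^sup>2 + (cmod y)\<^sup>2 - 2 * Re x - 2 * Re y + 1"

lemma crvar_iff_cross_ratio_rel: "X \<in> crvar \<longleftrightarrow> cross_ratio_rel (X$1) (X$2) (X$3)"
  by (simp add: crvar_def cross_ratio_rel_def)

text \<open>Turns the relations into polynomial identities over \<open>\<complex>\<close> by treating the conjugates as
  further variables.\<close>

lemma cross_ratio_rel_iff:
  "cross_ratio_rel x y z \<longleftrightarrow> x \<noteq> 0 \<and> x * cnj x * (z * cnj z) = y * cnj y \<and>
     x * cnj x * (z + cnj z) = x * cnj x + y * cnj y - (x + cnj x) - (y + cnj y) + 1"
proof (cases "x = 0")
  case False
  have 1: "(cmod z)\<^sup>2 = (cmod y)\<^sup>2 / (cmod x)\<^sup>2 \<longleftrightarrow> (cmod x)\<^sup>2 * (cmod z)\<^sup>2 = (cmod y)\<^sup>2"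
    using False by (simp add: field_simps)
  have "(cmod x)\<^sup>2 * (cmod z)\<^sup>2 = (cmod y)\<^sup>2 \<longleftrightarrow> x * cnj x * (z * cnj z) = y * cnj y"
    unfolding complex_norm_square[symmetric] of_real_mult[symmetric] of_real_eq_iff ..
  moreover have "x * cnj x * (z + cnj z) = x * cnj x + y * cnj y - (x + cnj x) - (y + cnj y) + 1 \<longleftrightarrow>
      (cmod x)\<^sup>2 * (2 * Re z) = (cmod x)\<^sup>2 + (cmod y)\<^sup>2 - 2 * Re x - 2 * Re y + 1"
  proof -
    have "x * cnj x * (z + cnj z) = of_real ((cmod x)\<^sup>2 * (2 * Re z))"
      by (simp only: of_real_mult[of "_ ^ 2"] complex_norm_square complex_add_cnj)
    moreover have "x * cnj x + y * cnj y - (x + cnj x) - (y + cnj y) + 1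
        = of_real ((cmod x)\<^sup>2 + (cmod y)\<^sup>2 - 2 * Re x - 2 * Re y + 1)"
      by (simp only: of_real_add of_real_diff of_real_1 complex_norm_square complex_add_cnj)
    ultimately show ?thesis by (simp only: of_real_eq_iff)
  qed
  moreover have "2 * (cmod x)\<^sup>2 * Re z = (cmod x)\<^sup>2 * (2 * Re z)" by simp
  ultimately show ?thesis unfolding cross_ratio_rel_def by (simp only: 1)
qed (simp add: cross_ratio_rel_def)

text \<open>One equation suffices for a singular point: with \<open>y = - x z\<close> the second defining equation
  reads \<open>\<bar>x (1 - z) - 1\<bar>\<^sup>2 = 0\<close>, from which the three singular equations follow. In terms of
  the quadruple, \<open>z1\<close> vanishes only on the singular set.\<close>

lemma cross_ratio_rel_CR_iff:
  assumes "cross_ratio_rel x y z" "Im z \<noteq> 0"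
  shows "(y \<noteq> 0 \<and> z \<noteq> 0 \<and> x + y = 1 \<and> 1 / y + 1 / z = 1 \<and> z + 1 / x = 1) \<longleftrightarrow> x * z + y = 0"
proof
  have x: "x \<noteq> 0" using assms by (simp add: cross_ratio_rel_def)
  {
    assume "y \<noteq> 0 \<and> z \<noteq> 0 \<and> x + y = 1 \<and> 1 / y + 1 / z = 1 \<and> z + 1 / x = 1"
    then have "x * (z + 1 / x) = x" "y = 1 - x" by (auto simp: algebra_simps)
    moreover have "x * (z + 1 / x) = x * z + 1" using x by (simp add: algebra_simps)
    ultimately have "x * z = x - 1" "y = 1 - x" by (simp_all add: eq_diff_eq)
    then show "x * z + y = 0" by simp
  }
  assume 0: "x * z + y = 0"
  have z: "z \<noteq> 0" "z \<noteq> 1" using assms(2) by auto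
  have y: "y = - (x * z)" using 0 by (simp add: eq_neg_iff_add_eq_0 add.commute)
  have "x * cnj x * (z + cnj z) = x * cnj x + y * cnj y - (x + cnj x) - (y + cnj y) + 1"
    using assms(1) cross_ratio_rel_iff by blast
  then have "(x * (1 - z) - 1) * cnj (x * (1 - z) - 1) = 0"
    unfolding y by (simp add: algebra_simps)
  then have "x * (1 - z) = 1" by (metis complex_mod_mult_cnj complex_cnj_cancel_iff complex_cnj_zero mult_eq_0_iff right_minus_eq)
  then have 1: "x * z = x - 1" by (simp add: algebra_simps)
  have inv: "1 / x = 1 - z" using \<open>x * (1 - z) = 1\<close> x by (metis nonzero_mult_div_cancel_left)
  have "1 / y = - ((1 / x) / z)" unfolding y by simp
  then have "1 / y + 1 / z = 1" unfolding inv using z by (simp add: field_simps)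
  moreover have "y \<noteq> 0" unfolding y using x z by simp
  moreover have "x + y = 1" unfolding y 1 by simp
  ultimately show "y \<noteq> 0 \<and> z \<noteq> 0 \<and> x + y = 1 \<and> 1 / y + 1 / z = 1 \<and> z + 1 / x = 1"
    using inv z by simp
qed

lemma crvar_reg_iff:
  "X \<in> crvar_reg \<longleftrightarrow> cross_ratio_rel (X$1) (X$2) (X$3) \<and> Im (X$3) \<noteq> 0 \<and> X$1 * X$3 + X$2 \<noteq> 0"
  using cross_ratio_rel_CR_iff[of "X$1" "X$2" "X$3"]
  unfolding crvar_reg_def crvar_star_def crvar_CR_def crvar_iff_cross_ratio_rel by auto

lemma crvar_reg_eq: "crvar_reg = (crvar - crvar_CR) \<inter> {X. Im (X$3) \<noteq> 0}"
  unfolding crvar_reg_def crvar_star_def by auto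

section \<open>The complex structure of the first two cross-ratios\<close>

text \<open>For given first two cross-ratios \<open>u\<close>, the second defining equation prescribes the real part
  of the third one, and then the first equation prescribes the square of its imaginary part.
  The argument \<open>s\<close> of the definitions below is the sign of the imaginary part.\<close>

definition ratio3_re :: "complex^2 \<Rightarrow> real" where
  "ratio3_re u = ((cmod (u$1))\<^sup>2 + (cmod (u$2))\<^sup>2 - 2 * Re (u$1) - 2 * Re (u$2) + 1) / (2 * (cmod (u$1))\<^sup>2)"

definition ratio3_im_sq :: "complex^2 \<Rightarrow> real" where
  "ratio3_im_sq u = (cmod (u$2))\<^sup>2 / (cmod (u$1))\<^sup>2 - (ratio3_re u)\<^sup>2"

definition ratio3 :: "real \<Rightarrow> complex^2 \<Rightarrow> complex" where
  "ratio3 s u = of_real (ratio3_re u) + \<i> * of_real (s * sqrt (ratio3_im_sq u))"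

definition inv_M :: "real \<Rightarrow> complex^2 \<Rightarrow> complex^3" where
  "inv_M s u = vector [u$1, u$2, ratio3 s u]"

text \<open>For \<open>s = 1\<close> and \<open>s = -1\<close> the two chart domains of \<open>I\<close> inside the regular part.\<close>

definition sheet :: "real \<Rightarrow> (complex^3) set" where
  "sheet s = {X \<in> crvar_reg. 0 < s * Im (X$3)}"

definition sheet_image :: "real \<Rightarrow> (complex^2) set" where
  "sheet_image s = {u. u$1 \<noteq> 0 \<and> 0 < ratio3_im_sq u \<and> u$1 * ratio3 s u + u$2 \<noteq> 0}"

lemma I_reg_eq: "I_reg = {(sheet 1, crmap_M), (sheet (-1), crmap_M)}"
proof -
  have "crvar_plus \<inter> crvar_reg = sheet 1" "crvar_minus \<inter> crvar_reg = sheet (-1)"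
    unfolding crvar_plus_def crvar_minus_def sheet_def crvar_reg_def by auto
  then show ?thesis by (simp add: I_reg_def restrict_atlas_def I_atlas_def)
qed

lemma smooth_on_ratio3:
  assumes "open S" "\<And>u. u \<in> S \<Longrightarrow> u$1 \<noteq> 0"
  shows "smooth_on S ratio3_re" "smooth_on S ratio3_im_sq"
    "(\<And>u. u \<in> S \<Longrightarrow> 0 < ratio3_im_sq u) \<Longrightarrow> smooth_on S (ratio3 s)"
proof -
  show re: "smooth_on S ratio3_re"
    unfolding ratio3_re_def using assms by (intro smooth_intros) auto
  show im2: "smooth_on S ratio3_im_sq"
    unfolding ratio3_im_sq_def power2_eq_square[of "ratio3_re _"] using assms re by (intro smooth_intros) auto
  assume "\<And>u. u \<in> S \<Longrightarrow> 0 < ratio3_im_sq u"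
  then show "smooth_on S (ratio3 s)"
    unfolding ratio3_def using assms re im2 by (intro smooth_intros) auto
qed

lemma open_sheet_image: "open (sheet_image s)"
proof -
  define A where "A = {u :: complex^2. u$1 \<noteq> 0}"
  have A: "open A"
    unfolding A_def by (intro open_Collect_neq continuous_intros)
  have "open (A \<inter> ratio3_im_sq -` {0<..})"
    using smooth_on_ratio3(2)[OF A] A
    by (intro continuous_open_preimage smooth_on_imp_continuous_on) (auto simp: A_def)
  then have B: "open {u. u$1 \<noteq> 0 \<and> 0 < ratio3_im_sq u}"
    by (simp add: A_def vimage_def Int_def)
  let ?B = "{u. u$1 \<noteq> 0 \<and> 0 < ratio3_im_sq u}"
  have "smooth_on ?B (\<lambda>u. u$1 * ratio3 s u + u$2)"
    using B by (intro smooth_intros smooth_on_ratio3(3)) auto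
  then have "open (?B \<inter> (\<lambda>u. u$1 * ratio3 s u + u$2) -` (-{0}))"
    by (intro continuous_open_preimage[OF smooth_on_imp_continuous_on B]) auto
  moreover have "\<dots> = sheet_image s" by (auto simp: sheet_image_def)
  ultimately show ?thesis by simp
qed

text \<open>A positive square determines the imaginary part up to the sign \<open>s\<close>, so each sheet is a graph
  over the first two cross-ratios.\<close>

lemma cross_ratio_rel_ratio3_iff:
  assumes s: "s = 1 \<or> s = -1" and x: "u$1 \<noteq> 0"
  shows "cross_ratio_rel (u$1) (u$2) z \<and> 0 < s * Im z \<longleftrightarrow> z = ratio3 s u \<and> 0 < ratio3_im_sq u"
proof -
  have re: "2 * (cmod (u$1))\<^sup>2 * Re z = (cmod (u$1))\<^sup>2 + (cmod (u$2))\<^sup>2 - 2 * Re (u$1) - 2 * Re (u$2) + 1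
      \<longleftrightarrow> Re z = ratio3_re u"
    unfolding ratio3_re_def using x by (simp add: field_simps)
  have s2: "s\<^sup>2 = 1" "s * s = 1" using s by auto
  have im: "(cmod z)\<^sup>2 = (cmod (u$2))\<^sup>2 / (cmod (u$1))\<^sup>2 \<longleftrightarrow> (s * Im z)\<^sup>2 = ratio3_im_sq u" if "Re z = ratio3_re u"
    unfolding ratio3_im_sq_def using that s2 by (auto simp: cmod_power2 power_mult_distrib)
  have "cross_ratio_rel (u$1) (u$2) z \<and> 0 < s * Im z \<longleftrightarrow>
      Re z = ratio3_re u \<and> (s * Im z)\<^sup>2 = ratio3_im_sq u \<and> 0 < s * Im z"
    unfolding cross_ratio_rel_def using x re im by auto
  also have "\<dots> \<longleftrightarrow> Re z = ratio3_re u \<and> s * Im z = sqrt (ratio3_im_sq u) \<and> 0 < ratio3_im_sq u"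
    by (metis less_imp_le real_sqrt_gt_0_iff real_sqrt_pow2 real_sqrt_unique)
  also have "\<dots> \<longleftrightarrow> z = ratio3 s u \<and> 0 < ratio3_im_sq u"
    unfolding ratio3_def complex_eq_iff using s by auto
  finally show ?thesis .
qed

lemma crmap_M_linear: "bounded_linear crmap_M"
  unfolding crmap_M_def linear_conv_bounded_linear[symmetric]
  by (intro linearI) (simp_all add: vec_eq_iff forall_2)

lemma inv_M_in_sheet:
  assumes "s = 1 \<or> s = -1" "u \<in> sheet_image s"
  shows "inv_M s u \<in> sheet s"
  using assms cross_ratio_rel_ratio3_iff[OF assms(1), of u "ratio3 s u"]
  by (auto simp: sheet_def sheet_image_def crvar_reg_iff inv_M_def)

lemma crmap_M_sheet:
  assumes "s = 1 \<or> s = -1" "X \<in> sheet s"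
  shows "crmap_M X \<in> sheet_image s" "inv_M s (crmap_M X) = X"
proof -
  have *: "X$3 = ratio3 s (crmap_M X)" "0 < ratio3_im_sq (crmap_M X)" "X$1 \<noteq> 0"
    using assms cross_ratio_rel_ratio3_iff[OF assms(1), of "crmap_M X" "X$3"]
    by (auto simp: sheet_def crvar_reg_iff crmap_M_def cross_ratio_rel_def)
  then show "inv_M s (crmap_M X) = X" by (simp add: inv_M_def vec_eq_iff forall_3 crmap_M_def)
  have "X$1 * X$3 + X$2 \<noteq> 0" using assms(2) by (simp add: sheet_def crvar_reg_iff)
  then show "crmap_M X \<in> sheet_image s"
    using * unfolding sheet_image_def by (simp add: crmap_M_def)
qed

lemma smooth_chart_sheet:
  assumes s: "s = 1 \<or> s = -1"
  shows "smooth_chart crvar_reg (sheet s) crmap_M"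
proof (rule smooth_chartI[where D = "sheet_image s" and \<psi> = "inv_M s" and F = crmap_M])
  have "sheet s = crvar_reg \<inter> {X. 0 < s * Im (X$3)}" by (auto simp: sheet_def)
  moreover have "open {X :: complex^3. 0 < s * Im (X$3)}"
    by (intro open_Collect_less continuous_intros)
  ultimately show "openin (top_of_set crvar_reg) (sheet s)" by (simp add: openin_open_Int)
  show "smooth_on (sheet_image s) (inv_M s)"
    unfolding inv_M_def by (intro smooth_intros smooth_on_ratio3(3) open_sheet_image) (auto simp: sheet_image_def)
  show "inv_M s ` sheet_image s \<subseteq> sheet s" "crmap_M ` sheet s \<subseteq> sheet_image s"
    using inv_M_in_sheet[OF s] crmap_M_sheet[OF s] by auto
  show "crmap_M (inv_M s u) = u" for u
    by (simp add: inv_M_def crmap_M_def vec_eq_iff forall_2)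
  show "crmap_M differentiable (at X)" for X
    using bounded_linear_imp_has_derivative[OF crmap_M_linear] unfolding differentiable_def by blast
qed (use open_sheet_image crmap_M_sheet[OF s] in auto)

lemma sheets_cover: "sheet 1 \<union> sheet (-1) = crvar_reg"
  by (auto simp: sheet_def crvar_reg_iff)

lemma complex_structure_I: "complex_structure crvar_reg I_reg"
proof -
  have "holomorphic_map_on (crmap_M ` (sheet s \<inter> sheet t)) (crmap_M \<circ> inv_into (sheet s) crmap_M)"
    if "s = 1 \<or> s = -1" "t = 1 \<or> t = -1" for s t
    by (rule holomorphic_transitionI[OF smooth_chart_sheet[OF that(2)] smooth_chart_sheet[OF that(1)] holomorphic_map_on_ident])
      auto
  note hol = this[of 1 1] this[of 1 "-1"] this[of "-1" 1] this[of "-1" "-1"]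
  show ?thesis
    unfolding complex_structure_def I_reg_eq using hol smooth_chart_sheet sheets_cover by simp
qed

section \<open>The complex structure of the normalised quadruple\<close>

lemma hpoint_scale: "c \<noteq> 0 \<Longrightarrow> hpoint (c * a) (c * b) = hpoint a b"
proof -
  assume c: "c \<noteq> 0"
  have "\<exists>d. k *s (vector [c * a, c * b] :: complex^2) = d *s vector [a, b]" for k
    by (rule exI[of _ "k * c"], unfold vec_eq_iff forall_2) simp
  moreover have "\<exists>d. k *s (vector [a, b] :: complex^2) = d *s vector [c * a, c * b]" for k
    by (rule exI[of _ "k / c"], unfold vec_eq_iff forall_2) (use c in simp)
  ultimately show ?thesis unfolding hpoint_def by blast
qed

text \<open>Together with \<open>hpoint_scale\<close> this identifies homogeneous coordinates by their cross product,
  which is what evaluates the affine coordinates.\<close>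

lemma hpoint_cross: "hpoint a b = hpoint c d \<Longrightarrow> a * d = b * c"
proof -
  assume "hpoint a b = hpoint c d"
  moreover have "1 *s vector [a, b] \<in> hpoint a b" unfolding hpoint_def by blast
  ultimately obtain k where "1 *s vector [a, b] = k *s (vector [c, d] :: complex^2)"
    unfolding hpoint_def by blast
  then have "a = k * c" "b = k * d" by (simp_all add: vec_eq_iff forall_2)
  then show ?thesis by simp
qed

lemma affine1_hpoint: "a \<noteq> 0 \<Longrightarrow> affine1 (hpoint a b) = b / a"
  unfolding affine1_def
  using hpoint_scale[of a 1 "b / a"] by (intro the_equality) (auto dest: hpoint_cross)

lemma affine2_hpoint: "b \<noteq> 0 \<Longrightarrow> affine2 (hpoint a b) = a / b"
  unfolding affine2_def
  using hpoint_scale[of b "a / b" 1] by (intro the_equality) (auto dest: hpoint_cross simp: field_simps)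

lemma hpoint_eq_axis_iff:
  assumes "a \<noteq> 0"
  shows "hpoint a b \<noteq> hpoint 0 1" "hpoint a b = hpoint 1 0 \<longleftrightarrow> b = 0"
  using assms hpoint_scale[OF assms, of 1 0] by (auto dest: hpoint_cross)

text \<open>The projective coordinate in \<open>crmap_N\<close> is \<open>[z1 : z4]\<close>, where \<open>z1\<close> and \<open>z4\<close> come from the
  normalised quadruple of points.\<close>

definition quad_z4 :: "complex^3 \<Rightarrow> complex" where "quad_z4 X = X$1 + X$2 - 1"
definition quad_z1 :: "complex^3 \<Rightarrow> complex" where "quad_z1 X = X$1 + X$2 / X$3"

lemma quad_z1_nonzero: "X \<in> crvar_reg \<Longrightarrow> quad_z1 X \<noteq> 0"
proof -
  assume X: "X \<in> crvar_reg"
  then have "quad_z1 X * X$3 = X$1 * X$3 + X$2" by (auto simp: quad_z1_def crvar_reg_iff field_simps)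
  then show "quad_z1 X \<noteq> 0" using X by (auto simp: crvar_reg_iff)
qed

text \<open>The charts of \<open>J\<close> on the regular part, written as functions that are holomorphic on an open
  subset of \<open>\<complex>\<^sup>3\<close>.\<close>

definition J_coord1 :: "complex^3 \<Rightarrow> complex^2" where "J_coord1 X = vector [quad_z4 X / quad_z1 X, X$3]"
definition J_coord2 :: "complex^3 \<Rightarrow> complex^2" where "J_coord2 X = vector [quad_z1 X / quad_z4 X, X$3]"

definition J_chart1 :: "complex^3 \<Rightarrow> complex^2" where
  "J_chart1 = (\<lambda>(L, z). vector [affine1 L, z]) \<circ> crmap_N"
definition J_chart2 :: "complex^3 \<Rightarrow> complex^2" where
  "J_chart2 = (\<lambda>(L, z). vector [affine2 L, z]) \<circ> crmap_N"

definition J_domain2 :: "(complex^3) set" where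
  "J_domain2 = {X \<in> crvar_reg. quad_z4 X \<noteq> 0}"

lemma crmap_N_reg: "X \<in> crvar_reg \<Longrightarrow> crmap_N X = (hpoint (quad_z1 X) (quad_z4 X), X$3)"
  using quad_z1_nonzero[of X] by (simp add: crmap_N_def quad_z1_def quad_z4_def Let_def)

lemma J_coord1_eq_chart1: "X \<in> crvar_reg \<Longrightarrow> J_coord1 X = J_chart1 X"
  using quad_z1_nonzero[of X] by (simp add: J_chart1_def J_coord1_def crmap_N_reg affine1_hpoint)

lemma J_coord2_eq_chart2: "X \<in> J_domain2 \<Longrightarrow> J_coord2 X = J_chart2 X"
  by (simp add: J_chart2_def J_coord2_def crmap_N_reg affine2_hpoint J_domain2_def)

lemma crmap_N_in_CP1: "X \<in> crvar_reg \<Longrightarrow> hpoint (quad_z1 X) (quad_z4 X) \<in> CP1"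
  using quad_z1_nonzero[of X] by (auto simp: CP1_def)

text \<open>Since \<open>z1\<close> does not vanish on the regular part, the first affine chart is defined on all of
  it.\<close>

lemma J_reg_eq: "J_reg = {(crvar_reg, J_chart1), (J_domain2, J_chart2)}"
proof -
  have nr: "X$3 \<notin> \<real>" if "X \<in> crvar_reg" for X
    using that by (auto simp: crvar_reg_iff complex_is_Real_iff)
  have sub: "crvar_reg \<subseteq> crvar_star" by (auto simp: crvar_reg_def)
  have N: "crmap_N X \<in> (CP1 - {hpoint 0 1}) \<times> (UNIV - \<real>)"
    "crmap_N X \<in> (CP1 - {hpoint 1 0}) \<times> (UNIV - \<real>) \<longleftrightarrow> quad_z4 X \<noteq> 0" if "X \<in> crvar_reg" for X
    using nr[OF that] crmap_N_in_CP1[OF that] hpoint_eq_axis_iff[OF quad_z1_nonzero[OF that], of "quad_z4 X"]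
    unfolding crmap_N_reg[OF that] by simp_all
  have "{X \<in> crvar_star. crmap_N X \<in> (CP1 - {hpoint 0 1}) \<times> (UNIV - \<real>)} \<inter> crvar_reg = crvar_reg"
    using sub N(1) by blast
  moreover have "{X \<in> crvar_star. crmap_N X \<in> (CP1 - {hpoint 1 0}) \<times> (UNIV - \<real>)} \<inter> crvar_reg = J_domain2"
  proof (rule set_eqI)
    fix X
    show "X \<in> {X \<in> crvar_star. crmap_N X \<in> (CP1 - {hpoint 1 0}) \<times> (UNIV - \<real>)} \<inter> crvar_reg \<longleftrightarrow> X \<in> J_domain2"
    proof (cases "X \<in> crvar_reg")
      case True
      then show ?thesis using sub by (simp only: Int_iff mem_Collect_eq N(2) J_domain2_def) blast
    qed (simp add: J_domain2_def)
  qed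
  ultimately show ?thesis
    unfolding J_reg_def J_atlas_def CP1_C_atlas_def restrict_atlas_def J_chart1_def J_chart2_def
    by (simp only: image_insert image_empty prod.case)
qed

text \<open>Let \<open>u = (t, z)\<close>. On the regular part \<open>w = y / (x z)\<close> has modulus one and \<open>w \<noteq> -1\<close>, so \<open>w =
  \<sigma> / cnj \<sigma>\<close> for exactly one \<open>\<sigma>\<close> with real part one. The second defining equation, divided by
  \<open>\<bar>x\<bar>\<^sup>2\<close>, becomes \<open>Re (z \<sigma>) = \<bar>t\<bar>\<^sup>2\<close>, which is linear in the imaginary part of \<open>\<sigma>\<close>; this is
  its solution.\<close>

definition sigma :: "complex^2 \<Rightarrow> complex" where
  "sigma u = 1 + \<i> * of_real ((Re (u$2) - (cmod (u$1))\<^sup>2) / Im (u$2))"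

text \<open>With \<open>y = x z w\<close>, the equation \<open>x + y - 1 = t (x + y/z)\<close> is linear in \<open>x\<close>; multiplied by
  \<open>cnj \<sigma>\<close>, it gives \<open>x\<close> with this denominator.\<close>

definition inv_N_denom :: "complex^2 \<Rightarrow> complex" where
  "inv_N_denom u = cnj (sigma u) + u$2 * sigma u - 2 * u$1"

definition inv_N :: "complex^2 \<Rightarrow> complex^3" where
  "inv_N u = vector [cnj (sigma u) / inv_N_denom u, u$2 * sigma u / inv_N_denom u, u$2]"

text \<open>The two equations on the right are \<open>Re \<sigma> = 1\<close> and \<open>Re (z \<sigma>) = \<bar>t\<bar>\<^sup>2\<close> without real parts.\<close>

lemma sigma_eq_iff:
  assumes "Im z \<noteq> 0"
  shows "\<sigma> = sigma (vector [t, z]) \<longleftrightarrow>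
    \<sigma> + cnj \<sigma> = 2 \<and> z * \<sigma> + cnj z * cnj \<sigma> = 2 * (t * cnj t)"
proof -
  have "2 * (t * cnj t) = of_real (2 * (cmod t)\<^sup>2)"
    by (simp only: of_real_mult of_real_numeral complex_norm_square)
  moreover have "z * \<sigma> + cnj z * cnj \<sigma> = of_real (2 * Re (z * \<sigma>))"
    using complex_add_cnj[of "z * \<sigma>"] by (simp only: complex_cnj_mult)
  ultimately have "z * \<sigma> + cnj z * cnj \<sigma> = 2 * (t * cnj t) \<longleftrightarrow> of_real (2 * Re (z * \<sigma>)) = (of_real (2 * (cmod t)\<^sup>2) :: complex)"
    by (simp only:)
  also have "\<dots> \<longleftrightarrow> Re z * Re \<sigma> - Im z * Im \<sigma> = (cmod t)\<^sup>2" unfolding of_real_eq_iff mult_cancel_left by simp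
  finally have 1: "z * \<sigma> + cnj z * cnj \<sigma> = 2 * (t * cnj t) \<longleftrightarrow> Re z * Re \<sigma> - Im z * Im \<sigma> = (cmod t)\<^sup>2" .
  have 2: "\<sigma> + cnj \<sigma> = 2 \<longleftrightarrow> Re \<sigma> = 1" by (auto simp: complex_eq_iff)
  have 3: "Re z - Im z * Im \<sigma> = (cmod t)\<^sup>2 \<longleftrightarrow> Im \<sigma> = (Re z - (cmod t)\<^sup>2) / Im z"
    using assms by (auto simp: field_simps)
  show ?thesis unfolding 1 2 sigma_def complex_eq_iff[of \<sigma>] using 3 by auto
qed

text \<open>If the denominator vanished, then \<open>2 t = cnj \<sigma> + z \<sigma>\<close>; comparing the resulting value of
  \<open>\<bar>t\<bar>\<^sup>2\<close> with \<open>Re (z \<sigma>)\<close> leaves \<open>\<bar>\<sigma>\<bar>\<^sup>2 \<bar>z - 1\<bar>\<^sup>2 = 0\<close>, which is impossible for a non-real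
  \<open>z\<close>.\<close>

lemma inv_N_denom_nonzero:
  assumes "Im (u$2) \<noteq> 0"
  shows "inv_N_denom u \<noteq> 0"
proof
  let ?\<sigma> = "sigma u" and ?z = "u$2" and ?t = "u$1"
  have u: "vector [?t, ?z] = u" by (simp add: vec_eq_iff forall_2)
  have \<sigma>: "cnj ?\<sigma> = 2 - ?\<sigma>" and 2: "?z * ?\<sigma> + cnj ?z * cnj ?\<sigma> = 2 * (?t * cnj ?t)"
    using sigma_eq_iff[OF assms, of "sigma u" ?t] u by (auto simp: algebra_simps)
  assume "inv_N_denom u = 0"
  then have t: "2 * ?t = cnj ?\<sigma> + ?z * ?\<sigma>" by (simp add: inv_N_denom_def)
  then have t': "2 * cnj ?t = ?\<sigma> + cnj ?z * cnj ?\<sigma>"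
    by (metis complex_cnj_add complex_cnj_cnj complex_cnj_mult complex_cnj_numeral)
  have "2 * (?z * ?\<sigma> + cnj ?z * cnj ?\<sigma>) = (2 * ?t) * (2 * cnj ?t)" using 2 by simp
  then have "2 * (?z * ?\<sigma> + cnj ?z * cnj ?\<sigma>) = (cnj ?\<sigma> + ?z * ?\<sigma>) * (?\<sigma> + cnj ?z * cnj ?\<sigma>)"
    unfolding t t' .
  then have "?\<sigma> * cnj ?\<sigma> * ((?z - 1) * (cnj ?z - 1)) = 0" unfolding \<sigma> by algebra
  moreover have "?\<sigma> \<noteq> 0" using \<sigma> by auto
  moreover have "?z - 1 \<noteq> 0" "cnj ?z - 1 \<noteq> 0" using assms by (auto simp: complex_eq_iff)
  ultimately show False by simp
qed

text \<open>The second defining equation is checked in the form \<open>\<bar>x + y - 1\<bar>\<^sup>2 = 2 \<bar>x\<bar>\<^sup>2 Re z + 2 Re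
  (cnj x y)\<close>, whose left-hand side is known from \<open>x + y - 1 = 2 t / d\<close>.\<close>

lemma inv_N_properties:
  assumes "Im (u$2) \<noteq> 0"
  shows "inv_N u \<in> crvar_reg" "quad_z4 (inv_N u) = 2 * u$1 / inv_N_denom u" "quad_z1 (inv_N u) = 2 / inv_N_denom u"
proof -
  define \<sigma> z t d where "\<sigma> = sigma u" "z = u$2" "t = u$1" "d = inv_N_denom u"
  have u: "vector [t, z] = u" by (simp add: vec_eq_iff forall_2 \<sigma>_z_t_d_def)
  have \<sigma>: "cnj \<sigma> = 2 - \<sigma>" and 2: "z * \<sigma> + cnj z * cnj \<sigma> = 2 * (t * cnj t)"
    using sigma_eq_iff[of z \<sigma> t] u assms by (auto simp: algebra_simps \<sigma>_z_t_d_def)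
  have d: "d \<noteq> 0" "d = cnj \<sigma> + z * \<sigma> - 2 * t"
    using inv_N_denom_nonzero[OF assms] by (simp_all add: \<sigma>_z_t_d_def inv_N_denom_def)
  have z: "z \<noteq> 0" "Im z \<noteq> 0" using assms by (auto simp: \<sigma>_z_t_d_def)
  have \<sigma>0: "\<sigma> \<noteq> 0" "cnj \<sigma> \<noteq> 0" using \<sigma> by auto
  define x y where "x = cnj \<sigma> / d" "y = z * \<sigma> / d"
  have X: "inv_N u $ 1 = x" "inv_N u $ 2 = y" "inv_N u $ 3 = z"
    by (simp_all add: inv_N_def x_y_def \<sigma>_z_t_d_def)
  show quad_z1: "quad_z1 (inv_N u) = 2 / inv_N_denom u"
    unfolding quad_z1_def X x_y_def using z \<sigma> by (simp add: add_divide_distrib[symmetric] \<sigma>_z_t_d_def(4)[symmetric])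
  show quad_z4: "quad_z4 (inv_N u) = 2 * u$1 / inv_N_denom u"
  proof -
    have "x + y = (d + 2 * t) / d" unfolding x_y_def using d(2) by (simp add: add_divide_distrib[symmetric])
    also have "\<dots> = 1 + 2 * t / d" using d(1) by (simp add: add_divide_distrib)
    finally show ?thesis unfolding quad_z4_def X \<sigma>_z_t_d_def(3,4)[symmetric] by simp
  qed
  have "x * z + y = 2 * z / d" unfolding x_y_def \<sigma> using d(1) by (simp add: field_simps)
  then have "x * z + y \<noteq> 0" using d(1) z by simp
  moreover have "cross_ratio_rel x y z" unfolding cross_ratio_rel_iff
  proof (intro conjI)
    show "x \<noteq> 0" using \<sigma>0 d by (simp add: x_y_def)
    show "x * cnj x * (z * cnj z) = y * cnj y"
      unfolding x_y_def by (simp add: mult_ac)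
    have b: "x + y - 1 = 2 * t / d" using quad_z4 by (simp add: quad_z4_def X \<sigma>_z_t_d_def)
    then have b': "cnj x + cnj y - 1 = 2 * cnj t / cnj d"
      by (metis complex_cnj_add complex_cnj_diff complex_cnj_divide complex_cnj_mult complex_cnj_numeral complex_cnj_one)
    have "(x + y - 1) * (cnj x + cnj y - 1) = 2 * (2 * (t * cnj t)) / (d * cnj d)"
      unfolding b b' by simp
    also have "\<dots> = 2 * (z * \<sigma> + cnj z * cnj \<sigma>) / (d * cnj d)" using 2 by simp
    also have "\<dots> = (cnj \<sigma> * \<sigma> * (z + cnj z) + cnj \<sigma> * cnj z * cnj \<sigma> + z * \<sigma> * \<sigma>) / (d * cnj d)"
      unfolding \<sigma> by (simp add: algebra_simps)
    also have "\<dots> = x * cnj x * (z + cnj z) + x * cnj y + y * cnj x"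
      unfolding x_y_def by (simp add: add_divide_distrib distrib_left mult_ac)
    finally show "x * cnj x * (z + cnj z) = x * cnj x + y * cnj y - (x + cnj x) - (y + cnj y) + 1"
      by (simp add: algebra_simps)
  qed
  ultimately show "inv_N u \<in> crvar_reg" unfolding crvar_reg_iff X using z by simp
qed

lemma J_coord1_inv_N: "Im (u$2) \<noteq> 0 \<Longrightarrow> J_coord1 (inv_N u) = u"
  using inv_N_properties[of u] inv_N_denom_nonzero[of u]
  by (simp add: J_coord1_def vec_eq_iff forall_2) (simp add: inv_N_def)

text \<open>With \<open>a = z1\<close> and \<open>b = z4\<close> at \<open>X\<close>, the parameter of the circle has to be \<open>\<sigma> = 2 y / (z a)\<close>,
  and the denominator \<open>2 / a\<close>. That this \<open>\<sigma>\<close> satisfies its two equations is what the two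
  defining equations of the variety say.\<close>

lemma inv_N_J_coord1:
  assumes X: "X \<in> crvar_reg"
  shows "inv_N (J_coord1 X) = X"
proof -
  define x y z a b where "x = X$1" "y = X$2" "z = X$3" "a = quad_z1 X" "b = quad_z4 X"
  note defs = x_y_z_a_b_def
  have rel: "cross_ratio_rel x y z" "Im z \<noteq> 0" using X by (auto simp: crvar_reg_iff defs)
  then have x: "x \<noteq> 0" and e1: "x * cnj x * (z * cnj z) = y * cnj y"
    and e2: "x * cnj x * (z + cnj z) = x * cnj x + y * cnj y - (x + cnj x) - (y + cnj y) + 1"
    unfolding cross_ratio_rel_iff by auto
  have z: "z \<noteq> 0" "cnj z \<noteq> 0" using rel(2) by auto
  have a: "a \<noteq> 0" "cnj a \<noteq> 0" using quad_z1_nonzero[OF X] by (simp_all add: defs)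
  have az: "a * z = x * z + y" "a = x + y / z" using z by (simp_all add: defs quad_z1_def field_simps)
  have az': "cnj a * cnj z = cnj x * cnj z + cnj y" using az(1)
    by (metis complex_cnj_add complex_cnj_mult)
  have b: "b = x + y - 1" "cnj b = cnj x + cnj y - 1" by (simp_all add: defs quad_z4_def)
  define \<sigma> where "\<sigma> = 2 * y / (z * a)"
  \<comment> \<open>The first defining equation in the form needed for \<open>cnj \<sigma> = 2 x / a\<close>.\<close>
  have "cnj y * (a * z) = x * z * (cnj a * cnj z)"
    unfolding az(1) az' using e1 by algebra
  then have "cnj \<sigma> = 2 * x / a"
    unfolding \<sigma>_def using a z by (simp add: field_simps)
  have "\<sigma> + cnj \<sigma> = 2 * (x + y / z) / a"
    unfolding \<open>cnj \<sigma> = 2 * x / a\<close> unfolding \<sigma>_def using z a by (simp add: field_simps)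
  then have s1: "\<sigma> + cnj \<sigma> = 2" using a(1) az(2)[symmetric] by simp
  have z\<sigma>: "z * \<sigma> = 2 * y / a" unfolding \<sigma>_def using z by simp
  then have z\<sigma>': "cnj z * cnj \<sigma> = 2 * cnj y / cnj a"
    by (metis complex_cnj_divide complex_cnj_mult complex_cnj_numeral)
  have "cnj z * (y * cnj a + cnj y * a) = cnj z * (b * cnj b)"
  proof -
    have "z * cnj z * (y * cnj a + cnj y * a) = z * cnj z * (b * cnj b)"
    proof -
      have "z * cnj z * (y * cnj a + cnj y * a) = y * z * (cnj a * cnj z) + cnj y * cnj z * (a * z)"
        by (simp add: algebra_simps)
      also have "\<dots> = z * cnj z * (b * cnj b)"
        unfolding az(1) az' b(2) unfolding b(1) using e1 e2 by algebra
      finally show ?thesis .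
    qed
    then show ?thesis using z by simp
  qed
  then have "y * cnj a + cnj y * a = b * cnj b" using z by simp
  moreover have "2 * y / a + 2 * cnj y / cnj a = 2 * ((y * cnj a + cnj y * a) / (a * cnj a))"
    using a by (simp add: field_simps)
  ultimately have s2: "z * \<sigma> + cnj z * cnj \<sigma> = 2 * (b / a * cnj (b / a))"
    unfolding z\<sigma> z\<sigma>' by simp
  have "J_coord1 X = vector [b / a, z]" by (simp add: J_coord1_def defs)
  then have sigma: "sigma (J_coord1 X) = \<sigma>" using sigma_eq_iff[OF rel(2), of \<sigma> "b / a"] s1 s2 by simp
  have p: "inv_N_denom (J_coord1 X) = 2 / a"
    unfolding inv_N_denom_def sigma \<open>cnj \<sigma> = 2 * x / a\<close>
    using a z\<sigma> by (simp add: J_coord1_def defs(3-5)[symmetric] b(1)) (simp add: field_simps)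
  show ?thesis
    unfolding inv_N_def p sigma \<open>cnj \<sigma> = 2 * x / a\<close>
    using a z\<sigma> by (simp add: vec_eq_iff forall_3 J_coord1_def defs(1-3)[symmetric]) 
qed

lemma has_derivative_vector_2:
  assumes "(f has_derivative f') F" "(g has_derivative g') F"
  shows "((\<lambda>x. vector [f x, g x] :: complex^2) has_derivative (\<lambda>v. vector [f' v, g' v])) F"
  unfolding vector_2_axis
  using assms by (intro has_derivative_add bounded_linear.has_derivative[OF bounded_linear_axis])

lemmas has_derivative_nth = bounded_linear.has_derivative[OF bounded_linear_vec_nth]

lemma has_derivative_quad_z4: "(quad_z4 has_derivative (\<lambda>v. v$1 + v$2)) (at p)"
  unfolding quad_z4_def by (auto intro!: derivative_eq_intros has_derivative_nth)

lemma has_derivative_quad_z1: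
  "p$3 \<noteq> 0 \<Longrightarrow> (quad_z1 has_derivative (\<lambda>v. v$1 + (v$2 * p$3 - p$2 * v$3) / (p$3 * p$3))) (at p)"
  unfolding quad_z1_def
  by (intro has_derivative_add has_derivative_divide' has_derivative_nth has_derivative_ident)

text \<open>What the comparison of \<open>I\<close> and \<open>J\<close> rests on: the derivative commutes with \<open>\<i>\<close>, and its
  second component is the third coordinate.\<close>

lemma has_derivative_J_coord1:
  assumes "p \<in> crvar_reg"
  obtains f' where "(J_coord1 has_derivative (\<lambda>v. vector [f' v, v$3])) (at p)" "\<And>v. f' (\<i> *s v) = \<i> * f' v"
proof -
  have p3: "p$3 \<noteq> 0" using assms by (auto simp: crvar_reg_iff)
  let ?n' = "\<lambda>v::complex^3. v$1 + v$2" and ?d' = "\<lambda>v::complex^3. v$1 + (v$2 * p$3 - p$2 * v$3) / (p$3 * p$3)"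
  let ?f' = "\<lambda>v. (?n' v * quad_z1 p - quad_z4 p * ?d' v) / (quad_z1 p * quad_z1 p)"
  have "((\<lambda>X. quad_z4 X / quad_z1 X) has_derivative ?f') (at p)"
    by (rule has_derivative_divide'[OF has_derivative_quad_z4 has_derivative_quad_z1[OF p3] quad_z1_nonzero[OF assms]])
  then have "(J_coord1 has_derivative (\<lambda>v. vector [?f' v, v$3])) (at p)"
    unfolding J_coord1_def by (intro has_derivative_vector_2 has_derivative_nth has_derivative_ident)
  moreover have "?f' (\<i> *s v) = \<i> * ?f' v" for v
    by (simp add: algebra_simps add_divide_distrib diff_divide_distrib)
  ultimately show thesis by (rule that[of ?f'])
qed

lemma open_nonreal: "open {u :: complex^2. Im (u$2) \<noteq> 0}"
  by (intro open_Collect_neq continuous_intros)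

lemma smooth_inv_N: "smooth_on {u. Im (u$2) \<noteq> 0} inv_N"
proof -
  have s: "smooth_on {u. Im (u$2) \<noteq> 0} sigma"
    unfolding sigma_def by (intro smooth_intros open_nonreal) auto
  then have "smooth_on {u. Im (u$2) \<noteq> 0} inv_N_denom"
    unfolding inv_N_denom_def by (intro smooth_intros open_nonreal)
  with s show ?thesis
    unfolding inv_N_def by (intro smooth_intros open_nonreal) (use inv_N_denom_nonzero in auto)
qed

lemma smooth_chart_J1: "smooth_chart crvar_reg crvar_reg J_chart1"
proof (rule smooth_chartI[where D = "{u. Im (u$2) \<noteq> 0}" and \<psi> = inv_N and F = J_coord1])
  show "J_chart1 ` crvar_reg \<subseteq> {u. Im (u$2) \<noteq> 0}"
    using J_coord1_eq_chart1[symmetric] by (auto simp: J_coord1_def crvar_reg_iff)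
  show "J_chart1 (inv_N u) = u" if "u \<in> {u. Im (u$2) \<noteq> 0}" for u
    using that J_coord1_inv_N inv_N_properties(1) J_coord1_eq_chart1 by simp
  show "inv_N (J_chart1 X) = X" if "X \<in> crvar_reg" for X
    using inv_N_J_coord1[OF that] J_coord1_eq_chart1[OF that] by simp
  show "J_coord1 differentiable (at X)" if "X \<in> crvar_reg" for X
    using has_derivative_J_coord1[OF that] unfolding differentiable_def by metis
qed (use open_nonreal smooth_inv_N inv_N_properties(1) J_coord1_eq_chart1 in auto)

lemma smooth_chart_J2: "smooth_chart crvar_reg J_domain2 J_chart2"
proof (rule smooth_chartI[where D = "{u. Im (u$2) \<noteq> 0 \<and> u$1 \<noteq> 0}"
      and \<psi> = "\<lambda>u. inv_N (vector [1 / u$1, u$2])" and F = J_coord2])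
  let ?D = "{u :: complex^2. Im (u$2) \<noteq> 0 \<and> u$1 \<noteq> 0}"
  show D: "open ?D"
    by (intro open_Collect_conj open_Collect_neq continuous_intros)
  have "J_domain2 = crvar_reg \<inter> {X. quad_z4 X \<noteq> 0}" by (auto simp: J_domain2_def)
  moreover have "open {X. quad_z4 X \<noteq> 0}"
    unfolding quad_z4_def by (intro open_Collect_neq continuous_intros)
  ultimately show "openin (top_of_set crvar_reg) J_domain2" by (metis openin_open_Int)
  show "smooth_on ?D (\<lambda>u. inv_N (vector [1 / u$1, u$2]))"
    by (rule smooth_on_compose[OF D open_nonreal _ _ smooth_inv_N]) (use D in \<open>auto intro!: smooth_intros\<close>)
  have *: "inv_N (vector [1 / u$1, u$2]) \<in> J_domain2" "J_coord2 (inv_N (vector [1 / u$1, u$2])) = u"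
    if "u \<in> ?D" for u
    using that inv_N_properties[of "vector [1 / u$1, u$2]"] inv_N_denom_nonzero[of "vector [1 / u$1, u$2]"]
    by (simp_all add: J_domain2_def J_coord2_def vec_eq_iff forall_2) (simp add: inv_N_def)
  then show "(\<lambda>u. inv_N (vector [1 / u$1, u$2])) ` ?D \<subseteq> J_domain2" by blast
  show "J_chart2 (inv_N (vector [1 / u$1, u$2])) = u" if "u \<in> ?D" for u
    using *[OF that] J_coord2_eq_chart2 by simp
  show "J_chart2 ` J_domain2 \<subseteq> ?D"
    using J_coord2_eq_chart2[symmetric] quad_z1_nonzero by (auto simp: J_coord2_def crvar_reg_iff J_domain2_def)
  show "inv_N (vector [1 / J_chart2 X $ 1, J_chart2 X $ 2]) = X" if "X \<in> J_domain2" for X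
  proof -
    have "vector [1 / J_coord2 X $ 1, J_coord2 X $ 2] = J_coord1 X" by (simp add: J_coord1_def J_coord2_def)
    then show ?thesis using inv_N_J_coord1 J_coord2_eq_chart2[OF that] that by (simp add: J_domain2_def)
  qed
  show "J_coord2 differentiable (at X)" if "X \<in> J_domain2" for X
  proof -
    have "X$3 \<noteq> 0" "quad_z4 X \<noteq> 0" using that by (auto simp: J_domain2_def crvar_reg_iff)
    then show ?thesis
      unfolding differentiable_def J_coord2_def
      using has_derivative_vector_2[OF has_derivative_divide'[OF has_derivative_quad_z1 has_derivative_quad_z4]
          has_derivative_nth[OF has_derivative_ident]] by blast
  qed
qed (use J_coord2_eq_chart2 in auto)

text \<open>The transition map between the two affine coordinates of the projective line.\<close>

lemma holomorphic_inversion: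
  fixes S :: "(complex^2) set"
  assumes S: "\<And>u. u \<in> S \<Longrightarrow> u$1 \<noteq> 0"
  shows "holomorphic_map_on S (\<lambda>u. vector [1 / u$1, u$2] :: complex^2)"
  unfolding holomorphic_map_on_def
proof
  fix u assume u: "u \<in> S"
  have "((\<lambda>u. vector [1 / u$1, u$2] :: complex^2) has_derivative
     (\<lambda>v. vector [(0 * u$1 - 1 * v$1) / (u$1 * u$1), v$2])) (at u)"
    by (intro has_derivative_vector_2 has_derivative_divide' has_derivative_const has_derivative_nth
        has_derivative_ident S u)
  then show "\<exists>f'. ((\<lambda>u. vector [1 / u$1, u$2] :: complex^2) has_derivative f') (at u)
      \<and> (\<forall>c v. f' (c *s v) = c *s f' v)"
    by (intro exI conjI allI) (auto simp: vec_eq_iff forall_2)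
qed

lemma complex_structure_J: "complex_structure crvar_reg J_reg"
proof -
  note c1 = smooth_chart_J1 and c2 = smooth_chart_J2
  have sub: "J_domain2 \<subseteq> crvar_reg" by (auto simp: J_domain2_def)
  have inv: "J_chart2 X = vector [1 / J_chart1 X $ 1, J_chart1 X $ 2]"
    "J_chart1 X = vector [1 / J_chart2 X $ 1, J_chart2 X $ 2]"
    "J_chart1 X $ 1 \<noteq> 0" "J_chart2 X $ 1 \<noteq> 0" if "X \<in> J_domain2" for X
    using J_coord2_eq_chart2[OF that, symmetric] J_coord1_eq_chart1[of X, symmetric] that quad_z1_nonzero[of X]
    by (simp_all add: J_coord1_def J_coord2_def J_domain2_def)
  have "holomorphic_map_on (J_chart1 ` (crvar_reg \<inter> crvar_reg)) (J_chart1 \<circ> inv_into crvar_reg J_chart1)"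
    by (rule holomorphic_transitionI[OF c1 c1 holomorphic_map_on_ident]) auto
  moreover have "holomorphic_map_on (J_chart2 ` (J_domain2 \<inter> J_domain2)) (J_chart2 \<circ> inv_into J_domain2 J_chart2)"
    by (rule holomorphic_transitionI[OF c2 c2 holomorphic_map_on_ident]) auto
  moreover have "holomorphic_map_on (J_chart1 ` (crvar_reg \<inter> J_domain2)) (J_chart2 \<circ> inv_into crvar_reg J_chart1)"
    by (rule holomorphic_transitionI[OF c2 c1 holomorphic_inversion]) (use inv(1,3) in auto)
  moreover have "holomorphic_map_on (J_chart2 ` (J_domain2 \<inter> crvar_reg)) (J_chart1 \<circ> inv_into J_domain2 J_chart2)"
    by (rule holomorphic_transitionI[OF c1 c2 holomorphic_inversion]) (use inv(2,4) in auto)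
  ultimately show ?thesis
    unfolding complex_structure_def J_reg_eq using c1 c2 sub by auto
qed

section \<open>Complex tangent lines of the variety\<close>

text \<open>The \<open>\<partial>\<close>-derivatives at \<open>p\<close> of the two defining functions \<open>\<bar>x\<bar>\<^sup>2 \<bar>z\<bar>\<^sup>2 - \<bar>y\<bar>\<^sup>2\<close> and \<open>\<bar>x\<bar>\<^sup>2 +
  \<bar>y\<bar>\<^sup>2 - 2 Re x - 2 Re y + 1 - 2 \<bar>x\<bar>\<^sup>2 Re z\<close>. The real derivative of each function is twice
  the real part of the form.\<close>

definition del_modulus :: "complex^3 \<Rightarrow> complex^3 \<Rightarrow> complex" where
  "del_modulus p v = cnj (p$1) * (p$3 * cnj (p$3)) * v$1 - cnj (p$2) * v$2 + p$1 * cnj (p$1) * cnj (p$3) * v$3"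

definition del_real_part :: "complex^3 \<Rightarrow> complex^3 \<Rightarrow> complex" where
  "del_real_part p v = (cnj (p$1) - 1 - cnj (p$1) * (p$3 + cnj (p$3))) * v$1 + (cnj (p$2) - 1) * v$2
     - p$1 * cnj (p$1) * v$3"

lemma del_linear:
  "del_modulus p (a - b) = del_modulus p a - del_modulus p b" "del_real_part p (a - b) = del_real_part p a - del_real_part p b"
  "del_modulus p (- a) = - del_modulus p a" "del_real_part p (- a) = - del_real_part p a"
  "del_modulus p (c *s a) = c * del_modulus p a" "del_real_part p (c *s a) = c * del_real_part p a"
  by (simp_all add: del_modulus_def del_real_part_def algebra_simps)

text \<open>Along a curve in the variety the defining functions vanish, hence so do their derivatives.\<close>

lemma tangent_space_del:
  assumes "v \<in> tangent_space crvar_reg p"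
  shows "Re (del_modulus p v) = 0" "Re (del_real_part p v) = 0"
proof -
  obtain \<epsilon> \<gamma> where \<gamma>: "0 < \<epsilon>" "\<gamma> ` {-\<epsilon><..<\<epsilon>} \<subseteq> crvar_reg"
    "\<gamma> (0::real) = p" "(\<gamma> has_vector_derivative v) (at 0)"
    using assms unfolding tangent_space_def by blast
  define x y z where "x = (\<lambda>t. \<gamma> t $ 1)" "y = (\<lambda>t. \<gamma> t $ 2)" "z = (\<lambda>t. \<gamma> t $ 3)"
  have p: "x 0 = p$1" "y 0 = p$2" "z 0 = p$3" using \<gamma>(3) by (simp_all add: x_y_z_def)
  have d: "(x has_vector_derivative v$1) (at 0)" "(y has_vector_derivative v$2) (at 0)"
    "(z has_vector_derivative v$3) (at 0)"
    unfolding x_y_z_def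
    by (auto intro!: bounded_linear.has_vector_derivative[OF bounded_linear_vec_nth] \<gamma>(4))
  note dc = d[THEN has_vector_derivative_cnj]
  have rel: "cross_ratio_rel (x t) (y t) (z t)" if "t \<in> {-\<epsilon><..<\<epsilon>}" for t
    using \<gamma>(2) that unfolding x_y_z_def image_subset_iff by (auto simp: crvar_reg_iff)
  have 0: "(0::real) \<in> {-\<epsilon><..<\<epsilon>}" using \<gamma>(1) by simp
  have zero: "D = 0" if "(f has_vector_derivative D) (at 0)" "\<And>t. t \<in> {-\<epsilon><..<\<epsilon>} \<Longrightarrow> f t = 0" for f :: "real \<Rightarrow> complex" and D
    using has_vector_derivative_transform_within_open[OF that(1) open_greaterThanLessThan 0, of "\<lambda>_. 0"] that(2)
      vector_derivative_at has_vector_derivative_const by metis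
  have "((\<lambda>t. x t * cnj (x t) * (z t * cnj (z t)) - y t * cnj (y t)) has_vector_derivative
      del_modulus p v + cnj (del_modulus p v)) (at 0)"
    by (rule has_vector_derivative_eq_rhs, (rule has_vector_derivative_diff has_vector_derivative_mult d dc)+)
      (simp add: p del_modulus_def algebra_simps)
  then have "del_modulus p v + cnj (del_modulus p v) = 0"
    by (rule zero) (use rel in \<open>simp add: cross_ratio_rel_iff\<close>)
  then show "Re (del_modulus p v) = 0" unfolding complex_add_cnj by simp
  have "((\<lambda>t. x t * cnj (x t) + y t * cnj (y t) - (x t + cnj (x t)) - (y t + cnj (y t)) + 1
        - x t * cnj (x t) * (z t + cnj (z t))) has_vector_derivative
      del_real_part p v + cnj (del_real_part p v)) (at 0)"
    by (rule has_vector_derivative_eq_rhs, (rule has_vector_derivative_diff has_vector_derivative_add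
          has_vector_derivative_mult has_vector_derivative_const d dc)+)
      (simp add: p del_real_part_def algebra_simps)
  then have "del_real_part p v + cnj (del_real_part p v) = 0"
    by (rule zero) (use rel in \<open>simp add: cross_ratio_rel_iff\<close>)
  then show "Re (del_real_part p v) = 0" unfolding complex_add_cnj by simp
qed

lemma sheet_exhaust:
  assumes "p \<in> crvar_reg"
  obtains s where "s = 1 \<or> s = -1" "p \<in> sheet s" "(sheet s, crmap_M) \<in> I_reg"
  using assms sheets_cover unfolding I_reg_eq by (metis UnE insertI1 insertI2)

lemma crmap_M_derivative: "(crmap_M has_derivative crmap_M) (at p)"
  by (rule bounded_linear_imp_has_derivative[OF crmap_M_linear])

lemma zero_if_Re_zero:
  assumes "Im a \<noteq> 0" "Re w = 0" "Re (a * w) = 0"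
  shows "w = 0"
  using assms by (simp add: complex_eq_iff)

text \<open>Given a vector \<open>v\<close> annihilated by both differentials, the chart of \<open>I\<close> provides a tangent
  vector \<open>u\<close> with the same first two coordinates. Then \<open>v - u\<close> has only a third coordinate,
  and the two equations, whose coefficients are \<open>\<bar>x\<bar>\<^sup>2\<close> times \<open>cnj z\<close> and \<open>-1\<close>, independent
  over \<open>\<real>\<close>, force it to vanish.\<close>

lemma tangent_space_crvar_reg:
  assumes p: "p \<in> crvar_reg"
  shows "tangent_space crvar_reg p = {v. Re (del_modulus p v) = 0 \<and> Re (del_real_part p v) = 0}"
proof (intro equalityI subsetI CollectI conjI)
  fix v assume v: "v \<in> {v. Re (del_modulus p v) = 0 \<and> Re (del_real_part p v) = 0}"
  obtain s where s: "s = 1 \<or> s = -1" "p \<in> sheet s" using sheet_exhaust[OF p] .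
  note ch = smooth_chart_sheet[OF s(1)]
  define u where "u = inv_chart_deriv (sheet s) crmap_M p (crmap_M v)"
  have T: "tangent_space crvar_reg p = range (inv_chart_deriv (sheet s) crmap_M p)"
    by (rule tangent_space_chart[OF ch s(2) _ crmap_M_derivative]) simp
  then have u: "u \<in> tangent_space crvar_reg p" unfolding u_def by blast
  have "crmap_M u = crmap_M v"
    unfolding u_def by (rule chart_deriv_left_inverse[OF ch s(2) _ crmap_M_derivative]) simp
  then have uv: "(v - u) $ 1 = 0" "(v - u) $ 2 = 0"
    by (simp_all add: crmap_M_def vec_eq_iff forall_2)
  define w where "w = p$1 * cnj (p$1) * (v - u) $ 3"
  have "Re (del_modulus p (v - u)) = 0" "Re (del_real_part p (v - u)) = 0"
    using tangent_space_del[OF u] v unfolding del_linear by auto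
  then have "Re (cnj (p$3) * w) = 0" "Re w = 0"
    unfolding del_modulus_def del_real_part_def uv by (simp_all add: w_def mult_ac)
  moreover have "Im (cnj (p$3)) \<noteq> 0" using p by (simp add: crvar_reg_iff)
  ultimately have "w = 0" using zero_if_Re_zero by blast
  then have "(v - u) $ 3 = 0" using p by (simp add: w_def crvar_reg_iff cross_ratio_rel_def)
  with uv have "v = u" by (simp add: vec_eq_iff forall_3)
  with u show "v \<in> tangent_space crvar_reg p" by simp
qed (use tangent_space_del in auto)

text \<open>The double cross product identity \<open>v \<times> (a \<times> b) = (v \<bullet> b) a - (v \<bullet> a) b\<close> shows that \<open>v \<times> c =
  0\<close>.\<close>

lemma orthogonal_cross_parallel:
  fixes a1 a2 a3 b1 b2 b3 v1 v2 v3 c1 c2 c3 :: complex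
  assumes c: "c1 = a2 * b3 - a3 * b2" "c2 = a3 * b1 - a1 * b3" "c3 = a1 * b2 - a2 * b1"
    and "c1 \<noteq> 0 \<or> c2 \<noteq> 0 \<or> c3 \<noteq> 0"
    and "a1 * v1 + a2 * v2 + a3 * v3 = 0" "b1 * v1 + b2 * v2 + b3 * v3 = 0"
  obtains k where "v1 = k * c1" "v2 = k * c2" "v3 = k * c3"
proof -
  have *: "v1 * c2 = v2 * c1" "v1 * c3 = v3 * c1" "v2 * c3 = v3 * c2"
    using assms(5,6) unfolding c by algebra+
  consider "c1 \<noteq> 0" | "c2 \<noteq> 0" | "c3 \<noteq> 0" using assms(4) by blast
  then show thesis
  proof cases
    case 1 then show thesis using * by (intro that[of "v1 / c1"]) (simp_all add: field_simps)
  next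
    case 2 then show thesis using * by (intro that[of "v2 / c2"]) (simp_all add: field_simps)
  next
    case 3 then show thesis using * by (intro that[of "v3 / c3"]) (simp_all add: field_simps)
  qed
qed

text \<open>The vector \<open>-Z\<close> is the cross product of the two forms. The first component uses \<open>\<bar>y\<bar>\<^sup>2 /
  \<bar>z\<bar>\<^sup>2 = \<bar>x\<bar>\<^sup>2\<close>, the third one both defining equations.\<close>

lemma Z_coeff_cross:
  assumes p: "p \<in> crvar_reg"
  defines "x \<equiv> p$1" and "y \<equiv> p$2" and "z \<equiv> p$3"
  shows "- (Z_coeff p $ 1) = - cnj y * (- (x * cnj x)) - x * cnj x * cnj z * (cnj y - 1)"
    "- (Z_coeff p $ 2) = x * cnj x * cnj z * (cnj x - 1 - cnj x * (z + cnj z))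
      - cnj x * (z * cnj z) * (- (x * cnj x))"
    "- (Z_coeff p $ 3) = cnj x * (z * cnj z) * (cnj y - 1)
      - (- cnj y) * (cnj x - 1 - cnj x * (z + cnj z))"
proof -
  have rel: "cross_ratio_rel x y z" "Im z \<noteq> 0" using p by (auto simp: crvar_reg_iff x_def y_def z_def)
  then have x: "x \<noteq> 0" and e1: "x * cnj x * (z * cnj z) = y * cnj y"
    and e2: "x * cnj x * (z + cnj z) = x * cnj x + y * cnj y - (x + cnj x) - (y + cnj y) + 1"
    unfolding cross_ratio_rel_iff by auto
  have z: "z \<noteq> 0" using rel(2) by auto
  have "(cmod y)\<^sup>2 / (cmod z)\<^sup>2 = (cmod x)\<^sup>2" using rel x z by (simp add: cross_ratio_rel_def field_simps)
  then have q: "of_real ((cmod y)\<^sup>2 / (cmod z)\<^sup>2) = x * cnj x" by (simp only: complex_norm_square)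
  show "- (Z_coeff p $ 1) = - cnj y * (- (x * cnj x)) - x * cnj x * cnj z * (cnj y - 1)"
    unfolding Z_coeff_def Let_def x_def[symmetric] y_def[symmetric] z_def[symmetric] q
    by (simp add: algebra_simps)
  show "- (Z_coeff p $ 2) = x * cnj x * cnj z * (cnj x - 1 - cnj x * (z + cnj z))
      - cnj x * (z * cnj z) * (- (x * cnj x))"
    unfolding Z_coeff_def Let_def x_def[symmetric] y_def[symmetric] z_def[symmetric] complex_norm_square
    by (simp add: algebra_simps)
  have "x * (cnj x * (z * cnj z) * (cnj y - 1) - (- cnj y) * (cnj x - 1 - cnj x * (z + cnj z)))
    = - (cnj y * (1 - cnj x - cnj y))"
    using e1 e2 by algebra
  then show "- (Z_coeff p $ 3) = cnj x * (z * cnj z) * (cnj y - 1)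
      - (- cnj y) * (cnj x - 1 - cnj x * (z + cnj z))"
    unfolding Z_coeff_def Let_def x_def[symmetric] y_def[symmetric] z_def[symmetric]
    using x by (simp add: field_simps)
qed

text \<open>If the last two components vanish, then so do \<open>1 + cnj x cnj z - cnj x\<close> and \<open>1 - cnj x - cnj
  y\<close>. Their difference is the conjugate of \<open>x z + y\<close>, which vanishes only at singular points.\<close>

lemma Z_coeff_nonzero:
  assumes p: "p \<in> crvar_reg"
  shows "Z_coeff p \<noteq> 0"
proof
  define x y z where "x = p$1" "y = p$2" "z = p$3"
  note defs = x_y_z_def
  have rel: "cross_ratio_rel x y z" "Im z \<noteq> 0" "x * z + y \<noteq> 0" using p by (auto simp: crvar_reg_iff defs)
  have x: "x \<noteq> 0" using rel by (simp add: cross_ratio_rel_def)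
  have z: "z \<noteq> 0" using rel(2) by auto
  have y: "y \<noteq> 0" using rel(1) x z by (auto simp: cross_ratio_rel_def)
  assume "Z_coeff p = 0"
  then have "Z_coeff p $ 2 = 0" "Z_coeff p $ 3 = 0" by simp_all
  then have "1 + cnj x * cnj z - cnj x = 0" "1 - cnj x - cnj y = 0"
    unfolding Z_coeff_def Let_def defs[symmetric] using x y z by simp_all
  moreover have "cnj (x * z + y) = (1 + cnj x * cnj z - cnj x) - (1 - cnj x - cnj y)" by simp
  ultimately have "cnj (x * z + y) = 0" by simp
  with rel(3) show False by (metis complex_cnj_zero_iff)
qed

lemma del_zero_iff:
  assumes p: "p \<in> crvar_reg"
  shows "del_modulus p v = 0 \<and> del_real_part p v = 0 \<longleftrightarrow> (\<exists>c. v = c *s Z_coeff p)"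
proof
  define a1 a2 a3 b1 b2 b3 where "a1 = cnj (p$1) * (p$3 * cnj (p$3))" "a2 = - cnj (p$2)"
    "a3 = p$1 * cnj (p$1) * cnj (p$3)" "b1 = cnj (p$1) - 1 - cnj (p$1) * (p$3 + cnj (p$3))"
    "b2 = cnj (p$2) - 1" "b3 = - (p$1 * cnj (p$1))"
  note ab = a1_a2_a3_b1_b2_b3_def
  have form: "del_modulus p w = a1 * w$1 + a2 * w$2 + a3 * w$3" "del_real_part p w = b1 * w$1 + b2 * w$2 + b3 * w$3" for w
    by (simp_all add: del_modulus_def del_real_part_def ab)
  have Z: "- (Z_coeff p $ 1) = a2 * b3 - a3 * b2" "- (Z_coeff p $ 2) = a3 * b1 - a1 * b3"
    "- (Z_coeff p $ 3) = a1 * b2 - a2 * b1"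
    using Z_coeff_cross[OF p] unfolding ab by simp_all
  {
    assume "del_modulus p v = 0 \<and> del_real_part p v = 0"
    moreover have "- (Z_coeff p $ 1) \<noteq> 0 \<or> - (Z_coeff p $ 2) \<noteq> 0 \<or> - (Z_coeff p $ 3) \<noteq> 0"
      using Z_coeff_nonzero[OF p] by (auto simp: vec_eq_iff forall_3)
    ultimately obtain k where "v$1 = k * - (Z_coeff p $ 1)" "v$2 = k * - (Z_coeff p $ 2)" "v$3 = k * - (Z_coeff p $ 3)"
      using orthogonal_cross_parallel[OF Z] unfolding form by blast
    then have "v = (- k) *s Z_coeff p" by (simp add: vec_eq_iff forall_3)
    then show "\<exists>c. v = c *s Z_coeff p" by blast
  }
  assume "\<exists>c. v = c *s Z_coeff p"
  then obtain c where v: "v = c *s Z_coeff p" by blast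
  have "del_modulus p (Z_coeff p) = 0" "del_real_part p (Z_coeff p) = 0"
    unfolding form using Z by algebra+
  then show "del_modulus p v = 0 \<and> del_real_part p v = 0" unfolding v del_linear by simp
qed

text \<open>The real parts of a complex linear form at \<open>v\<close> and at \<open>\<i> *s v\<close> are its real part and, up to
  sign, its imaginary part at \<open>v\<close>. So \<open>v\<close> and \<open>\<i> *s v\<close> are both tangent exactly when both
  forms vanish at \<open>v\<close>.\<close>

lemma complex_tangent_iff:
  assumes p: "p \<in> crvar_reg"
  shows "v \<in> tangent_space crvar_reg p \<and> \<i> *s v \<in> tangent_space crvar_reg p \<longleftrightarrow> (\<exists>c. v = c *s Z_coeff p)"
  unfolding tangent_space_crvar_reg[OF p] del_zero_iff[OF p, symmetric]
  by (auto simp: del_linear complex_eq_iff)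

text \<open>Near a regular point the condition \<open>Im z \<noteq> 0\<close> is open, so the larger set has the same
  tangent space there.\<close>

lemma CR_space_iff:
  assumes p: "p \<in> crvar_reg"
  shows "v \<in> CR_space (crvar - crvar_CR) p \<longleftrightarrow> (\<exists>c. v = c *s Z_coeff p)"
proof -
  let ?T = "tangent_space crvar_reg p"
  have "tangent_space (crvar - crvar_CR) p = ?T"
    unfolding crvar_reg_eq
    by (rule tangent_space_local[symmetric])
      (use p in \<open>auto simp: crvar_reg_iff intro!: open_Collect_neq continuous_intros\<close>)
  moreover have "v \<in> (\<lambda>w. \<i> *s w) ` ?T \<longleftrightarrow> \<i> *s v \<in> ?T"
  proof
    assume "v \<in> (\<lambda>w. \<i> *s w) ` ?T"
    then obtain w where "w \<in> ?T" "v = \<i> *s w" by blast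
    then show "\<i> *s v \<in> ?T" unfolding tangent_space_crvar_reg[OF p] by (simp add: del_linear)
  next
    assume "\<i> *s v \<in> ?T"
    then have "(- \<i>) *s v \<in> ?T" unfolding tangent_space_crvar_reg[OF p] by (simp add: del_linear)
    moreover have "v = \<i> *s ((- \<i>) *s v)" by (simp add: vec_eq_iff)
    ultimately show "v \<in> (\<lambda>w. \<i> *s w) ` ?T" by blast
  qed
  ultimately show ?thesis unfolding CR_space_def using complex_tangent_iff[OF p] by auto
qed

section \<open>The pseudoconformal structure\<close>

text \<open>The chart of \<open>I\<close> controls the first two coordinates of \<open>I X\<close>, and the chart of \<open>J\<close> the third
  coordinate of \<open>J X\<close>. So where \<open>I\<close> and \<open>J\<close> agree they are the multiplication of \<open>\<complex>\<^sup>3\<close>.\<close>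

lemma cstr_ops_ambient:
  assumes p: "p \<in> crvar_reg" and X: "X \<in> tangent_space crvar_reg p"
  shows "cstr_op I_reg p X = cstr_op J_reg p X \<Longrightarrow> cstr_op I_reg p X = \<i> *s X"
    "\<i> *s X \<in> tangent_space crvar_reg p \<Longrightarrow> cstr_op I_reg p X = \<i> *s X"
    "\<i> *s X \<in> tangent_space crvar_reg p \<Longrightarrow> cstr_op J_reg p X = \<i> *s X"
    "cstr_op I_reg p X \<in> tangent_space crvar_reg p"
proof -
  obtain s where s: "p \<in> sheet s" "(sheet s, crmap_M) \<in> I_reg" using sheet_exhaust[OF p] .
  obtain f' where f': "(J_coord1 has_derivative (\<lambda>v. vector [f' v, v$3])) (at p)" "\<And>v. f' (\<i> *s v) = \<i> * f' v"
    by (rule has_derivative_J_coord1[OF p]) (rule that)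
  have J1: "(crvar_reg, J_chart1) \<in> J_reg" by (simp add: J_reg_eq)
  have "crmap_M (cstr_op I_reg p X) = \<i> *s crmap_M X"
    by (rule cstr_op_extension(2)[OF complex_structure_I s(2,1) _ crmap_M_derivative X]) simp
  then have I: "cstr_op I_reg p X $ 1 = \<i> * X$1" "cstr_op I_reg p X $ 2 = \<i> * X$2"
    by (simp_all add: crmap_M_def vec_eq_iff forall_2)
  have "vector [f' (cstr_op J_reg p X), cstr_op J_reg p X $ 3] = \<i> *s (vector [f' X, X$3] :: complex^2)"
    by (rule cstr_op_extension(2)[OF complex_structure_J J1 p J_coord1_eq_chart1 f'(1) X])
  then have J: "cstr_op J_reg p X $ 3 = \<i> * X$3" by (simp add: vec_eq_iff forall_2)
  show "cstr_op I_reg p X \<in> tangent_space crvar_reg p"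
    by (rule cstr_op_extension(1)[OF complex_structure_I s(2,1) _ crmap_M_derivative X]) simp
  show "cstr_op I_reg p X = \<i> *s X" if "cstr_op I_reg p X = cstr_op J_reg p X"
    using I J that by (simp add: vec_eq_iff forall_3)
  show "cstr_op I_reg p X = \<i> *s X" if "\<i> *s X \<in> tangent_space crvar_reg p"
    by (rule cstr_op_eq_ambient[OF complex_structure_I s(2,1) _ crmap_M_derivative _ X that])
      (simp_all add: crmap_M_def vec_eq_iff forall_2)
  show "cstr_op J_reg p X = \<i> *s X" if "\<i> *s X \<in> tangent_space crvar_reg p"
    by (rule cstr_op_eq_ambient[OF complex_structure_J J1 p J_coord1_eq_chart1 f'(1) _ X that])
      (simp_all add: f'(2) vec_eq_iff forall_2)
qed

lemma cscale_d_zeta: "cscale c (d_zeta a) = d_zeta (c *s a)"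
  by (simp add: cscale_def d_zeta_def vec_eq_iff complex_eq_iff algebra_simps)

text \<open>Scaling by the formal imaginary unit of the complexified tangent space acts on a vector of
  type \<open>(1,0)\<close> as multiplication by \<open>\<i>\<close> on its first component.\<close>

lemma Z_line_eq: "{cscale c (Z_field p) | c. True} = {(X, - (\<i> *s X)) | X. \<exists>c. X = c *s Z_coeff p}"
proof -
  have d: "d_zeta a = (let X = (1/2) *s a in (X, - (\<i> *s X)))" for a :: "complex^3"
    by (simp add: d_zeta_def vec_eq_iff complex_eq_iff)
  show ?thesis
  proof (intro equalityI subsetI)
    fix w assume "w \<in> {cscale c (Z_field p) | c. True}"
    then obtain c where "w = d_zeta (c *s Z_coeff p)" by (auto simp: Z_field_def cscale_d_zeta)
    then show "w \<in> {(X, - (\<i> *s X)) | X. \<exists>c. X = c *s Z_coeff p}"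
      unfolding d Let_def by (auto intro!: exI[of _ "c / 2"])
  next
    fix w assume "w \<in> {(X, - (\<i> *s X)) | X. \<exists>c. X = c *s Z_coeff p}"
    then obtain c where "w = (c *s Z_coeff p, - (\<i> *s (c *s Z_coeff p)))" by blast
    then have "w = d_zeta ((2 * c) *s Z_coeff p)" unfolding d Let_def by simp
    then show "w \<in> {cscale c (Z_field p) | c. True}" unfolding Z_field_def cscale_d_zeta by blast
  qed
qed

lemma T10_common:
  assumes p: "p \<in> crvar_reg"
  shows "T10 crvar_reg I_reg p \<inter> T10 crvar_reg J_reg p = {cscale c (Z_field p) | c. True}"
proof (intro equalityI subsetI)
  fix w assume "w \<in> T10 crvar_reg I_reg p \<inter> T10 crvar_reg J_reg p"
  then obtain X where X: "X \<in> tangent_space crvar_reg p" "w = (X, - cstr_op I_reg p X)"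
    "cstr_op I_reg p X = cstr_op J_reg p X"
    unfolding T10_def by auto
  have op: "cstr_op I_reg p X = \<i> *s X" by (rule cstr_ops_ambient(1)[OF p X(1,3)])
  then have "\<i> *s X \<in> tangent_space crvar_reg p"
    using cstr_ops_ambient(4)[OF p X(1)] by simp
  then show "w \<in> {cscale c (Z_field p) | c. True}"
    unfolding Z_line_eq complex_tangent_iff[OF p, symmetric] using X(1,2) op by auto
next
  fix w assume "w \<in> {cscale c (Z_field p) | c. True}"
  then obtain X where X: "w = (X, - (\<i> *s X))" "X \<in> tangent_space crvar_reg p" "\<i> *s X \<in> tangent_space crvar_reg p"
    unfolding Z_line_eq complex_tangent_iff[OF p, symmetric] by blast
  then show "w \<in> T10 crvar_reg I_reg p \<inter> T10 crvar_reg J_reg p"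
    unfolding T10_def using cstr_ops_ambient(2,3)[OF p X(2,3)] by auto
qed

text \<open>The coefficients extend by the same formula to the open set where the first and third
  coordinates are non-zero.\<close>

lemma smooth_Z_field: "smooth_map_on crvar_reg Z_field"
proof -
  define W where "W = {X :: complex^3. X$1 \<noteq> 0 \<and> X$3 \<noteq> 0}"
  have W: "open W" unfolding W_def by (intro open_Collect_conj open_Collect_neq continuous_intros)
  have "smooth_on W Z_coeff"
    unfolding Z_coeff_def Let_def by (intro smooth_intros W) (auto simp: W_def)
  moreover have "bounded_linear (d_zeta :: complex^3 \<Rightarrow> _)"
    unfolding d_zeta_def linear_conv_bounded_linear[symmetric]
    by (intro linearI) (auto simp: vec_eq_iff complex_eq_iff algebra_simps)
  ultimately have "smooth_on W Z_field"
    unfolding Z_field_def using smooth_on_bounded_linear W by blast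
  moreover have "crvar_reg \<subseteq> W" by (auto simp: W_def crvar_reg_iff cross_ratio_rel_def)
  ultimately show ?thesis unfolding smooth_map_on_def using W by blast
qed

lemma Z_field_nonzero: "p \<in> crvar_reg \<Longrightarrow> Z_field p \<noteq> 0"
  using Z_coeff_nonzero[of p] by (simp add: Z_field_def d_zeta_def zero_prod_def)

theorem theorem1p1:
  shows "psc_manifold crvar_reg I_reg J_reg \<and>
    (\<forall>H. psc_bundle crvar_reg I_reg J_reg H \<longrightarrow>
      (\<forall>p\<in>crvar_reg.
         underlying_real H p = CR_space (crvar - crvar_CR) p \<and>
         (\<forall>X\<in>underlying_real H p.
            cstr_op I_reg p X = \<i> *s X \<and> cstr_op J_reg p X = \<i> *s X) \<and>
         H p = CR10 (crvar - crvar_CR) p \<and>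
         H p = {cscale c (Z_field p) | c. True}))"
proof (intro conjI allI impI)
  have bundle_iff: "psc_bundle crvar_reg I_reg J_reg H \<longleftrightarrow>
      (\<forall>p\<in>crvar_reg. H p = {cscale c (Z_field p) | c. True})" for H
    by (rule psc_bundle_iff[OF smooth_Z_field Z_field_nonzero T10_common])
  have "psc_bundle crvar_reg I_reg J_reg (\<lambda>p. {cscale c (Z_field p) | c. True})"
    unfolding bundle_iff by blast
  then show "psc_manifold crvar_reg I_reg J_reg"
    unfolding psc_manifold_def
    using complex_structure_real_four_manifold[OF complex_structure_I] complex_structure_I complex_structure_J
    by blast
  fix H assume "psc_bundle crvar_reg I_reg J_reg H"
  then have H: "H p = {cscale c (Z_field p) | c. True}" if "p \<in> crvar_reg" for p
    using that unfolding bundle_iff by blast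
  show "\<forall>p\<in>crvar_reg.
         underlying_real H p = CR_space (crvar - crvar_CR) p \<and>
         (\<forall>X\<in>underlying_real H p.
            cstr_op I_reg p X = \<i> *s X \<and> cstr_op J_reg p X = \<i> *s X) \<and>
         H p = CR10 (crvar - crvar_CR) p \<and>
         H p = {cscale c (Z_field p) | c. True}"
  proof
    fix p assume p: "p \<in> crvar_reg"
    have HX: "H p = {(X, - (\<i> *s X)) | X. \<exists>c. X = c *s Z_coeff p}"
      unfolding H[OF p] by (rule Z_line_eq)
    have R: "underlying_real H p = {X. \<exists>c. X = c *s Z_coeff p}"
      unfolding underlying_real_def HX by force
    show "underlying_real H p = CR_space (crvar - crvar_CR) p \<and>
         (\<forall>X\<in>underlying_real H p.
            cstr_op I_reg p X = \<i> *s X \<and> cstr_op J_reg p X = \<i> *s X) \<and>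
         H p = CR10 (crvar - crvar_CR) p \<and>
         H p = {cscale c (Z_field p) | c. True}"
    proof (intro conjI ballI)
      show "underlying_real H p = CR_space (crvar - crvar_CR) p"
        unfolding R using CR_space_iff[OF p] by blast
      show "H p = CR10 (crvar - crvar_CR) p"
        unfolding HX CR10_def CR_space_iff[OF p] ..
      show "H p = {cscale c (Z_field p) | c. True}" by (rule H[OF p])
      fix X assume "X \<in> underlying_real H p"
      then have "X \<in> tangent_space crvar_reg p" "\<i> *s X \<in> tangent_space crvar_reg p"
        using complex_tangent_iff[OF p] unfolding R by blast+
      then show "cstr_op I_reg p X = \<i> *s X" "cstr_op J_reg p X = \<i> *s X"
        using cstr_ops_ambient(2,3)[OF p] by blast+
    qed
  qed
qed

end
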